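(* Let $X$ be a quasi-Banach space with trivial dual, i.e. $X^*=\{0\}$ (the only continuous linear functional on $X$ is $0$), and let $I=[0,1]$. Then the map $D:C^1_0(I;X)\to C(I;X)$, $Df=f'$, is surjective. In particular, every continuous function $f:[0,1]\to X$ has a primitive, i.e. there is a differentiable function $F:[0,1]\to X$ with $F'(t)=f(t)$ for all $0\le t\le 1$.
   Context: Quasi-Banach spaces are assumed (for convenience) to be $p$-normed for some $0<p<1$, i.e. the quasi-norm satisfies $\|x+y\|^p\le\|x\|^p+\|y\|^p$. Let $I=[0,1]$. $C(I;X)$ denotes the space of continuous functions $f:I\to X$, with quasi-norm $\|f\|_\infty=\max_{0\le t\le 1}\|f(t)\|$. $C^1(I;X)$ denotes the space of all $f\in C(I;X)$ which are differentiable at each $t\in I$ (one-sided at the endpoints) and such that the function $g:I^2\to X$ given by $g(t,t)=f'(t)$ and $g(s,t)=\frac{f(s)-f(t)}{s-t}$ for $s\ne t$ is continuous on $I^2$; it is a quasi-Banach space under $\|f\|_{C^1}=\|f(0)\|+\sup_{0\le s<t\le 1}\frac{\|f(t)-f(s)\|}{t-s}$. $C^1_0(I;X)$ is the closed subspace of those $f\in C^1(I;X)$ with $f(0)=0$. The map $D:C^1_0(I;X)\to C(I;X)$ is $Df=f'$. *)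

theory Defs
  imports "HOL-Analysis.Analysis"
begin

class qnorm =
  fixes qnorm :: "'a \<Rightarrow> real"

text \<open>
  A \<open>p\<close>-normed quasi-Banach space over the reals. The quasi-norm does not satisfy the triangle
  inequality, so it is the \<open>p\<close>-th power of the quasi-norm that is the metric (and hence gives the
  topology and the notion of completeness). In particular \<^const>\<open>qnorm\<close> is unrelated to
  \<^const>\<open>norm\<close>, and these spaces need not be locally convex.
\<close>

class quasi_banach = real_vector + complete_space + qnorm +
  assumes qnorm_nonneg: "0 \<le> qnorm x"
    and qnorm_eq_zero: "qnorm x = 0 \<longleftrightarrow> x = 0"
    and qnorm_scaleR: "qnorm (a *\<^sub>R x) = \<bar>a\<bar> * qnorm x"
    and p_normed: "\<exists>p. 0 < p \<and> p < 1 \<and>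
      (\<forall>x y. qnorm (x + y) powr p \<le> qnorm x powr p + qnorm y powr p) \<and>
      (\<forall>x y. dist x y = qnorm (x - y) powr p)"

definition diff_quot :: "(real \<Rightarrow> 'a::real_vector) \<Rightarrow> real \<Rightarrow> real \<Rightarrow> 'a" where
  "diff_quot f s t = (f s - f t) /\<^sub>R (s - t)"

text \<open>
  The library's \<open>has_vector_derivative\<close> requires a normed space, so differentiability on the unit
  interval is defined by the limit of difference quotients; the limit within the interval is
  one-sided at the endpoints.
\<close>

definition has_derivI :: "(real \<Rightarrow> 'a::quasi_banach) \<Rightarrow> 'a \<Rightarrow> real \<Rightarrow> bool" where
  "has_derivI f v t \<longleftrightarrow> ((\<lambda>s. diff_quot f s t) \<longlongrightarrow> v) (at t within {0..1})"

definition derivI :: "(real \<Rightarrow> 'a::quasi_banach) \<Rightarrow> real \<Rightarrow> 'a" where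
  "derivI f t = Lim (at t within {0..1}) (\<lambda>s. diff_quot f s t)"

text \<open>
  Functions on the unit interval are represented as functions on the reals that are
  \<^const>\<open>undefined\<close> outside the interval, so that equality in the function spaces is
  equality on the interval.
\<close>

definition CI :: "(real \<Rightarrow> 'a::quasi_banach) set" where
  "CI = {f \<in> extensional {0..1}. continuous_on {0..1} f}"

definition C1I :: "(real \<Rightarrow> 'a::quasi_banach) set" where
  "C1I = {f \<in> CI. (\<forall>t\<in>{0..1}. \<exists>v. has_derivI f v t) \<and>
     continuous_on ({0..1} \<times> {0..1}) (\<lambda>(s, t). if s = t then derivI f t else diff_quot f s t)}"

definition C1I0 :: "(real \<Rightarrow> 'a::quasi_banach) set" where
  "C1I0 = {f \<in> C1I. f 0 = 0}"

definition D :: "(real \<Rightarrow> 'a::quasi_banach) \<Rightarrow> real \<Rightarrow> 'a" where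
  "D f = restrict (derivI f) {0..1}"

end

theory Submission
  imports Defs
begin

text \<open>
  If the dual is trivial, the convex hull of every ball is the whole space (Hahn--Banach applied to
  the Minkowski-type seminorm \<open>mackey\<close>), so every vector is an average of arbitrarily small ones.
  Hence for each \<open>x\<close> and \<open>\<epsilon>\<close> there is a path from \<open>0\<close> to \<open>x\<close> with local velocities below \<open>\<epsilon>\<close> but
  Lipschitz constant at most a universal multiple of \<open>\<parallel>x\<parallel>\<close>: the linear path is refined many times,
  each refinement living on a much smaller scale than the previous one, so that a difference
  quotient feels only one of them. Now let \<open>S\<close> have derivative \<open>f\<close> up to an error \<open>\<delta>\<close>. On each cell of a
  fine partition replace \<open>S\<close> by a linear function of slope \<open>f\<close> plus such a slow path carrying the
  remaining increment. The error becomes arbitrarily small, while \<open>S\<close> changes only by a function with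
  Lipschitz constant \<open>O(\<delta>)\<close>. Iterating gives a convergent sequence whose limit is a primitive of \<open>f\<close>.
\<close>

section \<open>Hahn--Banach and decompositions into small vectors\<close>

definition sublinear :: "('a::real_vector \<Rightarrow> real) \<Rightarrow> bool" where
  "sublinear q \<longleftrightarrow> (\<forall>x y. q (x + y) \<le> q x + q y) \<and> (\<forall>a x. 0 \<le> a \<longrightarrow> q (a *\<^sub>R x) = a * q x)"

lemma sublinear_add: "sublinear q \<Longrightarrow> q (x + y) \<le> q x + q y"
  by (simp add: sublinear_def)

lemma sublinear_scale: "sublinear q \<Longrightarrow> 0 \<le> a \<Longrightarrow> q (a *\<^sub>R x) = a * q x"
  by (simp add: sublinear_def)

lemma sublinear_zero: "sublinear q \<Longrightarrow> q 0 = 0"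
  using sublinear_scale[of q 0 0] by simp

lemma sublinear_ge: "sublinear q \<Longrightarrow> - q (- x) \<le> q x"
  using sublinear_add[of q x "- x"] sublinear_zero[of q] by simp

text \<open>Directedness gives subadditivity: \<open>q\<close> and \<open>r\<close> have a common
  lower bound \<open>k\<close> in \<open>Q\<close>, so \<open>q x + r y\<close> dominates
  \<open>k (x + y)\<close>, and the two infima can then be taken separately.\<close>

lemma sublinear_INF:
  fixes Q :: "('a::real_vector \<Rightarrow> real) set"
  assumes "Q \<noteq> {}" and sub: "\<And>q. q \<in> Q \<Longrightarrow> sublinear q"
    and bdd: "\<And>x. bdd_below ((\<lambda>q. q x) ` Q)"
    and dir: "\<And>q r. q \<in> Q \<Longrightarrow> r \<in> Q \<Longrightarrow> \<exists>k\<in>Q. k \<le> q \<and> k \<le> r"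
  shows "sublinear (\<lambda>x. INF q\<in>Q. q x)"
  unfolding sublinear_def
proof (intro conjI allI impI)
  fix x y
  show "(INF q\<in>Q. q (x + y)) \<le> (INF q\<in>Q. q x) + (INF q\<in>Q. q y)"
  proof -
    have "(INF q\<in>Q. q (x + y)) - (INF q\<in>Q. q y) \<le> q x" if q: "q \<in> Q" for q
    proof -
      have "(INF q\<in>Q. q (x + y)) - q x \<le> r y" if r: "r \<in> Q" for r
      proof -
        obtain k where k: "k \<in> Q" "k \<le> q" "k \<le> r" using dir q r by blast
        have "(INF q\<in>Q. q (x + y)) \<le> k (x + y)" by (rule cINF_lower[OF bdd k(1)])
        also have "\<dots> \<le> k x + k y" by (rule sublinear_add[OF sub[OF k(1)]])
        also have "\<dots> \<le> q x + r y" using k by (simp add: le_fun_def add_mono)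
        finally show ?thesis by simp
      qed
      then have "(INF q\<in>Q. q (x + y)) - q x \<le> (INF r\<in>Q. r y)"
        by (intro cINF_greatest[OF assms(1)])
      then show ?thesis by simp
    qed
    then have "(INF q\<in>Q. q (x + y)) - (INF q\<in>Q. q y) \<le> (INF q\<in>Q. q x)"
      by (intro cINF_greatest[OF assms(1)])
    then show ?thesis by simp
  qed
next
  fix a :: real and x assume a: "0 \<le> a"
  have le: "(INF q\<in>Q. q (b *\<^sub>R z)) \<ge> b * (INF q\<in>Q. q z)" if "b \<ge> 0" for b z
    by (rule cINF_greatest[OF assms(1)])
       (simp add: sublinear_scale[OF sub that] mult_left_mono[OF cINF_lower[OF bdd] that])
  show "(INF q\<in>Q. q (a *\<^sub>R x)) = a * (INF q\<in>Q. q x)"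
  proof (cases "a = 0")
    case True
    have "(INF q\<in>Q. q 0) = (INF q\<in>Q. 0::real)"
      by (rule INF_cong) (auto simp: sublinear_zero sub)
    with True assms(1) show ?thesis by simp
  next
    case False
    have "inverse a * (INF q\<in>Q. q (a *\<^sub>R x)) \<le> (INF q\<in>Q. q x)"
      using le[of "inverse a" "a *\<^sub>R x"] a False by simp
    then have "(INF q\<in>Q. q (a *\<^sub>R x)) \<le> a * (INF q\<in>Q. q x)"
      using a False by (simp add: field_simps)
    with le[OF a, of x] show ?thesis by simp
  qed
qed

text \<open>The witness is the infimum of \<open>q (x + t *\<^sub>R y) - t * q y\<close> over
  \<open>t \<ge> 0\<close>; \<open>t = 0\<close> gives \<open>r \<le> q\<close> and
  \<open>t = 1\<close> the last claim. For a minimal \<open>q\<close> this forces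
  \<open>r = q\<close>, and the last claim becomes the reverse of subadditivity.\<close>

lemma sublinear_improve:
  fixes q :: "'a::real_vector \<Rightarrow> real"
  assumes q: "sublinear q"
  obtains r where "sublinear r" "r \<le> q" "\<And>x. r x \<le> q (x + y) - q y"
proof
  define R where "R x = (\<lambda>t. q (x + t *\<^sub>R y) - t * q y) ` {0..}" for x
  define r where "r x = Inf (R x)" for x
  \<comment> \<open>The infimum is finite because \<open>t * q y = q (t *\<^sub>R y)\<close> is at
    most \<open>q (x + t *\<^sub>R y) + q (- x)\<close>.\<close>
  have lower: "- q (- x) \<le> q (x + t *\<^sub>R y) - t * q y" if "t \<ge> 0" for x t
    using sublinear_add[OF q, of "x + t *\<^sub>R y" "- x"] sublinear_scale[OF q that, of y] by simp
  have bdd: "bdd_below (R x)" for x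
    unfolding R_def using lower by (intro bdd_belowI2[where m = "- q (- x)"]) auto
  have r_le: "r x \<le> q (x + t *\<^sub>R y) - t * q y" if "t \<ge> 0" for x t
    unfolding r_def using that by (intro cInf_lower[OF _ bdd]) (auto simp: R_def)
  have r_ge: "c \<le> r x" if "\<And>t. t \<ge> 0 \<Longrightarrow> c \<le> q (x + t *\<^sub>R y) - t * q y" for c x
    unfolding r_def using that by (intro cInf_greatest) (auto simp: R_def)
  show "r \<le> q" using r_le[of 0] by (auto simp: le_fun_def)
  show "r x \<le> q (x + y) - q y" for x using r_le[of 1 x] by simp
  have add: "r (x + x') \<le> r x + r x'" for x x'
  proof -
    have "r (x + x') - r x' \<le> q (x + t *\<^sub>R y) - t * q y" if t: "t \<ge> 0" for t
    proof -
      have "r (x + x') - (q (x + t *\<^sub>R y) - t * q y) \<le> q (x' + u *\<^sub>R y) - u * q y"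
        if u: "u \<ge> 0" for u
      proof -
        have "r (x + x') \<le> q ((x + x') + (t + u) *\<^sub>R y) - (t + u) * q y"
          using t u by (intro r_le) simp
        also have "(x + x') + (t + u) *\<^sub>R y = (x + t *\<^sub>R y) + (x' + u *\<^sub>R y)"
          by (simp add: algebra_simps)
        also have "q \<dots> \<le> q (x + t *\<^sub>R y) + q (x' + u *\<^sub>R y)" by (rule sublinear_add[OF q])
        finally show ?thesis by (simp add: algebra_simps)
      qed
      from r_ge[OF this] show ?thesis by simp
    qed
    from r_ge[OF this] show ?thesis by simp
  qed
  have scale: "a * r x \<le> r (a *\<^sub>R x)" if a: "a > 0" for a x
  proof (rule r_ge)
    fix t :: real assume t: "t \<ge> 0"
    have "a * r x \<le> a * (q (x + (t / a) *\<^sub>R y) - (t / a) * q y)"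
      using a t by (intro mult_left_mono r_le) auto
    also have "\<dots> = q (a *\<^sub>R (x + (t / a) *\<^sub>R y)) - t * q y"
      using a by (simp add: sublinear_scale[OF q] right_diff_distrib del: scaleR_add_right)
    also have "a *\<^sub>R (x + (t / a) *\<^sub>R y) = a *\<^sub>R x + t *\<^sub>R y"
      using a by (simp add: algebra_simps)
    finally show "a * r x \<le> q (a *\<^sub>R x + t *\<^sub>R y) - t * q y" .
  qed
  have zero: "r 0 = 0"
  proof (rule antisym)
    show "r 0 \<le> 0" using r_le[of 0 0] sublinear_zero[OF q] by simp
    show "0 \<le> r 0" by (rule r_ge) (simp add: sublinear_scale[OF q])
  qed
  show "sublinear r"
    unfolding sublinear_def
  proof (intro conjI allI impI add)
    fix a :: real and x assume a: "0 \<le> a"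
    show "r (a *\<^sub>R x) = a * r x"
    proof (cases "a = 0")
      case False
      with a have "a > 0" by simp
      moreover from scale[of "inverse a" "a *\<^sub>R x"] this have "inverse a * r (a *\<^sub>R x) \<le> r x" by simp
      ultimately have "r (a *\<^sub>R x) \<le> a * r x" by (simp add: field_simps)
      with scale[OF \<open>a > 0\<close>, of x] show ?thesis by simp
    qed (simp add: zero)
  qed
qed

text \<open>A minimal sublinear functional is linear, by \<open>sublinear_improve\<close>.\<close>

theorem hahn_banach_sublinear:
  fixes q :: "'a::real_vector \<Rightarrow> real"
  assumes "sublinear q"
  obtains \<phi> where "linear \<phi>" "\<And>x. \<phi> x \<le> q x" "\<phi> z = q z"
proof -
  \<comment> \<open>Minimising below \<open>q'\<close> rather than \<open>q\<close> fixes the value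
    at \<open>z\<close>: since \<open>q' (- z) \<le> - q z\<close>, every linear functional below
    \<open>q'\<close> is at least \<open>q z\<close> at \<open>z\<close>.\<close>
  obtain q' where q': "sublinear q'" "q' \<le> q" "\<And>x. q' x \<le> q (x + z) - q z"
    using sublinear_improve[OF assms, of z] by blast
  define A where "A = {r. sublinear r \<and> r \<le> q'}"
  \<comment> \<open>The order is reversed, so that the maximal element from Zorn's lemma is a
    minimal sublinear functional.\<close>
  let ?P = "\<lambda>r s :: 'a \<Rightarrow> real. s \<le> r"
  have po: "partial_order_on A (relation_of ?P A)"
    by (rule partial_order_on_relation_ofI) auto
  have "\<exists>m\<in>A. \<forall>a\<in>A. ?P m a \<longrightarrow> a = m"
  proof (rule predicate_Zorn[OF po])
    fix C assume "C \<in> Chains (relation_of ?P A)"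
    then have CA: "C \<subseteq> A" and chain: "\<And>r s. r \<in> C \<Longrightarrow> s \<in> C \<Longrightarrow> s \<le> r \<or> r \<le> s"
      by (auto simp: Chains_def relation_of_def)
    show "\<exists>u\<in>A. \<forall>a\<in>C. u \<le> a"
    proof (cases "C = {}")
      case True
      then show ?thesis using q' by (auto simp: A_def)
    next
      case False
      have lower: "- q' (- x) \<le> r x" if "r \<in> C" for r x
      proof -
        from that CA have "sublinear r" "r (- x) \<le> q' (- x)" by (auto simp: A_def le_fun_def)
        with sublinear_ge[of r x] show ?thesis by linarith
      qed
      have bdd: "bdd_below ((\<lambda>r. r x) ` C)" for x
        by (rule bdd_belowI2[where m = "- q' (- x)"]) (rule lower)
      let ?u = "\<lambda>x. INF r\<in>C. r x"
      have "sublinear ?u"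
        using False bdd CA chain by (intro sublinear_INF) (auto simp: A_def, blast)
      moreover have le: "?u \<le> r" if "r \<in> C" for r
        using cINF_lower[OF bdd that] by (simp add: le_fun_def)
      moreover have "?u \<le> q'"
      proof -
        from False obtain r where "r \<in> C" by blast
        with CA le[of r] show ?thesis unfolding A_def by (blast intro: order_trans)
      qed
      ultimately show ?thesis by (auto simp: A_def)
    qed
  qed
  then obtain \<phi> where \<phi>: "sublinear \<phi>" "\<phi> \<le> q'"
    and min: "\<And>r. sublinear r \<Longrightarrow> r \<le> \<phi> \<Longrightarrow> r = \<phi>"
    unfolding A_def by (auto intro: order_trans)
  have add: "\<phi> (x + y) = \<phi> x + \<phi> y" for x y
  proof -
    obtain r where r: "sublinear r" "r \<le> \<phi>" "\<And>x. r x \<le> \<phi> (x + y) - \<phi> y"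
      using sublinear_improve[OF \<phi>(1), of y] by blast
    with min have "r = \<phi>" by blast
    with r(3)[of x] sublinear_add[OF \<phi>(1), of x y] show ?thesis by simp
  qed
  have neg: "\<phi> (- x) = - \<phi> x" for x
    using add[of x "- x"] sublinear_zero[OF \<phi>(1)] by simp
  have "linear \<phi>"
  proof (rule linearI)
    fix a :: real and x
    show "\<phi> (a *\<^sub>R x) = a *\<^sub>R \<phi> x"
      using sublinear_scale[OF \<phi>(1), of a x] sublinear_scale[OF \<phi>(1), of "- a" x] neg[of "a *\<^sub>R x"]
      by (cases "a \<ge> 0") auto
  qed (rule add)
  moreover have le: "\<phi> x \<le> q x" for x
    using \<phi>(2) q'(2) by (meson le_fun_def order_trans)
  moreover have "\<phi> z = q z"
  proof -
    have "\<phi> (- z) \<le> q' (- z)" using \<phi>(2) by (simp add: le_fun_def)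
    with q'(3)[of "- z"] sublinear_zero[OF assms] neg[of z] have "q z \<le> \<phi> z" by simp
    with le show ?thesis by (simp add: antisym)
  qed
  ultimately show ?thesis using that by blast
qed

section \<open>The p-th power of the quasi-norm as a translation-invariant metric\<close>

locale p_exponent =
  fixes p :: real and ty :: "'a::quasi_banach itself"
  assumes p_pos: "0 < p" and p_less_1: "p < 1"
    and powr_triangle: "\<And>x y :: 'a. qnorm (x + y) powr p \<le> qnorm x powr p + qnorm y powr p"
    and dist_powr: "\<And>x y :: 'a. dist x y = qnorm (x - y) powr p"
begin

text \<open>Subadditive but homogeneous only of degree \<open>p\<close>. A bound
  \<open>c * (t - s) powr p\<close> on \<open>pn\<close> of an increment is a Lipschitz condition
  for the quasi-norm, with constant \<open>c powr (1 / p)\<close>.\<close>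

definition pn :: "'a \<Rightarrow> real" where "pn x = qnorm x powr p"

lemma pn_nonneg [simp]: "0 \<le> pn x"
  by (simp add: pn_def)

lemma pn_zero [simp]: "pn 0 = 0"
  using qnorm_eq_zero[of "0::'a"] by (simp add: pn_def)

lemma pn_scale: "pn (a *\<^sub>R x) = \<bar>a\<bar> powr p * pn x"
  by (simp add: pn_def qnorm_scaleR powr_mult qnorm_nonneg)

lemma pn_uminus [simp]: "pn (- x) = pn x"
  using pn_scale[of "-1" x] by simp

lemma pn_minus_commute: "pn (x - y) = pn (y - x)"
  using pn_uminus[of "x - y"] by simp

lemma pn_add: "pn (x + y) \<le> pn x + pn y"
  by (simp add: pn_def powr_triangle)

lemma pn_diff: "pn (x - y) \<le> pn x + pn y"
  using pn_add[of x "- y"] by simp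

lemma pn_sum: "pn (sum f A) \<le> (\<Sum>i\<in>A. pn (f i))"
proof (induction A rule: infinite_finite_induct)
  case (insert a A)
  then show ?case using pn_add[of "f a" "sum f A"] by simp
qed simp_all

lemma dist_pn: "dist x y = pn (x - y)"
  by (simp add: pn_def dist_powr)

lemma powr_le_self: "a \<ge> 1 \<Longrightarrow> a powr p \<le> a"
  using powr_mono[of p 1 a] p_less_1 by simp

lemma tendsto_pn_iff: "(f \<longlongrightarrow> l) F \<longleftrightarrow> ((\<lambda>x. pn (f x - l)) \<longlongrightarrow> 0) F"
  by (subst tendsto_dist_iff) (simp only: dist_pn)

lemma tendsto_diff_pn:
  assumes "(f \<longlongrightarrow> a) F" "(g \<longlongrightarrow> b) F"
  shows "((\<lambda>x. f x - g x) \<longlongrightarrow> (a - b :: 'a)) F"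
  unfolding tendsto_pn_iff
proof (rule tendsto_sandwich[OF _ _ tendsto_const])
  show "((\<lambda>x. pn (f x - a) + pn (g x - b)) \<longlongrightarrow> 0) F"
    using assms by (auto intro!: tendsto_add_zero simp: tendsto_pn_iff)
  have "pn (f x - g x - (a - b)) \<le> pn (f x - a) + pn (g x - b)" for x
    using pn_diff[of "f x - a" "g x - b"] by (simp add: algebra_simps)
  then show "\<forall>\<^sub>F x in F. pn (f x - g x - (a - b)) \<le> pn (f x - a) + pn (g x - b)" by simp
qed auto

lemma tendsto_scaleR_pn:
  assumes c: "(c \<longlongrightarrow> k) F" and g: "(g \<longlongrightarrow> b) F"
  shows "((\<lambda>x. c x *\<^sub>R g x) \<longlongrightarrow> (k *\<^sub>R b :: 'a)) F"
  unfolding tendsto_pn_iff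
proof (rule tendsto_sandwich[OF _ _ tendsto_const])
  have pow: "((\<lambda>x. \<bar>f x\<bar> powr p) \<longlongrightarrow> \<bar>l\<bar> powr p) F" if "(f \<longlongrightarrow> l) F" for f and l :: real
    by (rule tendsto_powr2[OF tendsto_rabs[OF that] tendsto_const]) (use p_pos in auto)
  have "((\<lambda>x. c x - k) \<longlongrightarrow> 0) F"
    using tendsto_diff[OF c tendsto_const, of k] by simp
  then have "((\<lambda>x. \<bar>c x\<bar> powr p * pn (g x - b) + \<bar>c x - k\<bar> powr p * pn b)
      \<longlongrightarrow> \<bar>k\<bar> powr p * 0 + \<bar>0\<bar> powr p * pn b) F"
    using g[unfolded tendsto_pn_iff] by (intro tendsto_add tendsto_mult tendsto_const pow c)
  then show "((\<lambda>x. \<bar>c x\<bar> powr p * pn (g x - b) + \<bar>c x - k\<bar> powr p * pn b) \<longlongrightarrow> 0) F" by simp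
  have "pn (c x *\<^sub>R g x - k *\<^sub>R b) \<le> \<bar>c x\<bar> powr p * pn (g x - b) + \<bar>c x - k\<bar> powr p * pn b" for x
  proof -
    have "c x *\<^sub>R g x - k *\<^sub>R b = c x *\<^sub>R (g x - b) + (c x - k) *\<^sub>R b"
      by (simp add: algebra_simps)
    then show ?thesis by (metis pn_add pn_scale)
  qed
  then show "\<forall>\<^sub>F x in F. pn (c x *\<^sub>R g x - k *\<^sub>R b)
      \<le> \<bar>c x\<bar> powr p * pn (g x - b) + \<bar>c x - k\<bar> powr p * pn b" by simp
qed auto

text \<open>The largest seminorm below the quasi-norm, i.e. the Minkowski functional of the convex
  hull of the unit ball, written as the least total cost of a finite decomposition.\<close>

definition mackey :: "'a \<Rightarrow> real" where
  "mackey x = Inf ((\<lambda>xs. \<Sum>y\<leftarrow>xs. qnorm y) ` {xs. sum_list xs = x})"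

lemma mackey_lower: "sum_list xs = x \<Longrightarrow> mackey x \<le> (\<Sum>y\<leftarrow>xs. qnorm y)"
  unfolding mackey_def
  by (intro cINF_lower bdd_belowI2[where m = 0]) (auto intro!: sum_list_nonneg simp: qnorm_nonneg)

lemma mackey_greatest: "(\<And>xs. sum_list xs = x \<Longrightarrow> c \<le> (\<Sum>y\<leftarrow>xs. qnorm y)) \<Longrightarrow> c \<le> mackey x"
  unfolding mackey_def
  by (rule cINF_greatest) (auto intro: exI[of _ "[x]"])

lemma mackey_le_qnorm: "mackey x \<le> qnorm x"
  using mackey_lower[of "[x]"] by simp

text \<open>Decompositions of \<open>x\<close> and of \<open>y\<close> can be appended, and scaling
  a decomposition by \<open>b > 0\<close> scales its cost. The second homogeneity inequality is the
  first one for \<open>inverse a\<close>.\<close>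

lemma sublinear_mackey: "sublinear mackey"
  unfolding sublinear_def
proof (intro conjI allI impI)
  fix x y
  have "mackey (x + y) - mackey x \<le> mackey y"
  proof (rule mackey_greatest)
    fix ys assume ys: "sum_list ys = y"
    have "mackey (x + y) - (\<Sum>y\<leftarrow>ys. qnorm y) \<le> mackey x"
    proof (rule mackey_greatest)
      fix xs assume "sum_list xs = x"
      with ys have "mackey (x + y) \<le> (\<Sum>y\<leftarrow>xs @ ys. qnorm y)" by (intro mackey_lower) simp
      then show "mackey (x + y) - (\<Sum>y\<leftarrow>ys. qnorm y) \<le> (\<Sum>y\<leftarrow>xs. qnorm y)" by simp
    qed
    then show "mackey (x + y) - mackey x \<le> (\<Sum>y\<leftarrow>ys. qnorm y)" by simp
  qed
  then show "mackey (x + y) \<le> mackey x + mackey y" by simp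
next
  fix a :: real and x assume a: "0 \<le> a"
  have le: "mackey (b *\<^sub>R z) \<le> b * mackey z" if b: "b > 0" for b z
  proof -
    have "mackey (b *\<^sub>R z) / b \<le> mackey z"
    proof (rule mackey_greatest)
      fix xs assume xs: "sum_list xs = z"
      have "sum_list (map ((*\<^sub>R) b) xs) = b *\<^sub>R sum_list xs" for xs :: "'a list"
        by (induction xs) (auto simp: algebra_simps)
      with xs have "mackey (b *\<^sub>R z) \<le> (\<Sum>y\<leftarrow>map ((*\<^sub>R) b) xs. qnorm y)"
        by (intro mackey_lower) simp
      also have "\<dots> = b * (\<Sum>y\<leftarrow>xs. qnorm y)"
        using b by (simp add: o_def qnorm_scaleR sum_list_const_mult)
      finally show "mackey (b *\<^sub>R z) / b \<le> (\<Sum>y\<leftarrow>xs. qnorm y)" using b by (simp add: field_simps)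
    qed
    then show ?thesis using b by (simp add: field_simps)
  qed
  show "mackey (a *\<^sub>R x) = a * mackey x"
  proof (cases "a = 0")
    case True
    have "mackey 0 \<le> 0" using mackey_lower[of "[]"] by simp
    moreover have "0 \<le> mackey 0"
      by (rule mackey_greatest) (auto intro!: sum_list_nonneg simp: qnorm_nonneg)
    ultimately show ?thesis using True by simp
  next
    case False
    with a have a: "a > 0" by simp
    with le[of "inverse a" "a *\<^sub>R x"] have "mackey x \<le> inverse a * mackey (a *\<^sub>R x)" by simp
    with a le[OF a, of x] show ?thesis by (simp add: field_simps)
  qed
qed

text \<open>The bound at \<open>y\<close> and at \<open>- y\<close> gives
  \<open>\<bar>\<phi> y\<bar> \<le> qnorm y\<close>; a quasi-norm below \<open>e\<close> corresponds
  to a distance below \<open>e powr p\<close>.\<close>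

lemma linear_continuous_if_le_qnorm:
  fixes \<phi> :: "'a \<Rightarrow> real"
  assumes lin: "linear \<phi>" and le: "\<And>x. \<phi> x \<le> qnorm x"
  shows "continuous_on UNIV \<phi>"
  unfolding continuous_on_iff
proof (intro ballI allI impI)
  fix x :: 'a and e :: real assume e: "e > 0"
  have abs: "\<bar>\<phi> y\<bar> \<le> qnorm y" for y
    using le[of y] le[of "- y"] qnorm_scaleR[of "-1" y] linear_neg[OF lin, of y] by simp
  show "\<exists>d>0. \<forall>y\<in>UNIV. dist y x < d \<longrightarrow> dist (\<phi> y) (\<phi> x) < e"
  proof (intro exI[of _ "e powr p"] conjI ballI impI)
    fix y assume "dist y x < e powr p"
    then have "qnorm (y - x) < e"
      using e p_pos by (metis dist_powr powr_less_cancel2 powr_mono2 not_le qnorm_nonneg less_imp_le)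
    with abs[of "y - x"] show "dist (\<phi> y) (\<phi> x) < e"
      by (simp add: dist_real_def linear_diff[OF lin])
  qed (use e in simp)
qed

text \<open>Each \<open>y\<close> is cut into \<open>\<lfloor>qnorm y / h\<rfloor> + 1\<close> equal
  pieces. Rounding up costs at most one extra piece per vector, so the number of pieces is
  controlled by the total cost.\<close>

lemma split_into_small_pieces:
  assumes h: "h > 0"
  shows "\<exists>zs. sum_list zs = sum_list ys \<and> (\<forall>z\<in>set zs. qnorm z \<le> h) \<and>
    h * length zs \<le> (\<Sum>y\<leftarrow>ys. qnorm y) + h * length (ys :: 'a list)"
proof (induction ys)
  case (Cons y ys)
  then obtain zs where zs: "sum_list zs = sum_list ys" "\<forall>z\<in>set zs. qnorm z \<le> h"
    "h * length zs \<le> (\<Sum>y\<leftarrow>ys. qnorm y) + h * length ys" by blast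
  define m where "m = nat \<lfloor>qnorm y / h\<rfloor> + 1"
  have nn: "0 \<le> qnorm y / h" using h by (simp add: qnorm_nonneg)
  have m: "qnorm y / h \<le> m" "m \<le> qnorm y / h + 1" "m > 0"
    using nn unfolding m_def by linarith+
  have rep: "sum_list (replicate k v) = real k *\<^sub>R v" for k and v :: 'a
    by (induction k) (auto simp: algebra_simps)
  have "sum_list (replicate m (y /\<^sub>R m) @ zs) = sum_list (y # ys)"
    using m(3) zs(1) by (simp add: rep)
  moreover have "qnorm (y /\<^sub>R m) \<le> h"
    using m(1,3) h by (simp add: qnorm_scaleR field_simps)
  moreover have "h * m \<le> qnorm y + h"
    using m(2) h by (simp add: field_simps)
  ultimately show ?case
    using zs by (intro exI[of _ "replicate m (y /\<^sub>R m) @ zs"]) (auto simp: algebra_simps)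
qed (auto intro: exI[of _ "[]"])

text \<open>A functional from Hahn--Banach equal to \<open>mackey x\<close> at \<open>x\<close> lies
  below \<open>qnorm\<close>, hence is continuous and zero; so \<open>mackey x = 0\<close>. A
  decomposition of small total cost, cut into pieces of nearly equal size, then exhibits
  \<open>x\<close> as the average of the small vectors \<open>real n *\<^sub>R z i\<close>.\<close>

lemma small_average:
  assumes trivial_dual: "\<And>\<phi> :: 'a \<Rightarrow> real. linear \<phi> \<Longrightarrow> continuous_on UNIV \<phi> \<Longrightarrow> \<phi> = (\<lambda>x. 0)"
    and d: "d > 0"
  obtains n :: nat and z :: "nat \<Rightarrow> 'a"
  where "n > 0" "(\<Sum>i<n. z i) = x" "\<And>i. i < n \<Longrightarrow> qnorm (real n *\<^sub>R z i) \<le> d"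
proof -
  have "mackey x = 0"
  proof -
    obtain \<phi> where \<phi>: "linear \<phi>" "\<And>y. \<phi> y \<le> mackey y" "\<phi> x = mackey x"
      using hahn_banach_sublinear[OF sublinear_mackey] by blast
    have "continuous_on UNIV \<phi>"
      using \<phi> mackey_le_qnorm by (intro linear_continuous_if_le_qnorm) (auto intro: order_trans)
    from trivial_dual[OF \<phi>(1) this] \<phi>(3) show ?thesis by simp
  qed
  have "\<exists>ys. sum_list ys = x \<and> (\<Sum>y\<leftarrow>ys. qnorm y) < d / 2"
    using mackey_greatest[of x "d / 2"] \<open>mackey x = 0\<close> d by fastforce
  then obtain ys where ys: "sum_list ys = x" "(\<Sum>y\<leftarrow>ys. qnorm y) < d / 2" by blast
  \<comment> \<open>With this \<open>h\<close>, the rounding pieces and the zero vector added below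
    cost \<open>d / 2\<close> together, and the total cost of \<open>ys\<close> is the other
    half.\<close>
  define h where "h = d / (2 * (length ys + 1))"
  have h: "h > 0" "h * (length ys + 1) = d / 2" using d by (auto simp: h_def field_simps)
  obtain zs where zs: "sum_list zs = x" "\<forall>z\<in>set zs. qnorm z \<le> h"
    "h * length zs \<le> (\<Sum>y\<leftarrow>ys. qnorm y) + h * length ys"
    using split_into_small_pieces[OF h(1), of ys] ys(1) by blast
  \<comment> \<open>The extra zero vector guarantees \<open>n > 0\<close> even when the
    decomposition is empty.\<close>
  define ws where "ws = 0 # zs"
  have q0: "qnorm (0::'a) = 0" using qnorm_eq_zero by blast
  show ?thesis
  proof (rule that[of "length ws" "\<lambda>i. ws ! i"])
    show "length ws > 0" by (simp add: ws_def)
    show "(\<Sum>i<length ws. ws ! i) = x"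
      using zs(1) sum_list_sum_nth[of ws] by (simp add: atLeast0LessThan ws_def)
    fix i assume "i < length ws"
    then have "ws ! i \<in> set ws" by simp
    then have "qnorm (ws ! i) \<le> h" using zs(2) h(1) q0 by (auto simp: ws_def)
    moreover have "h * length ws \<le> d"
      using zs(3) ys(2) h(2) by (simp add: ws_def algebra_simps)
    ultimately show "qnorm (real (length ws) *\<^sub>R ws ! i) \<le> d"
      by (simp add: qnorm_scaleR) (metis mult.commute mult_left_mono of_nat_0_le_iff order_trans)
  qed
qed

end

section \<open>Concatenation of paths\<close>

text \<open>The paths \<open>g 0, ..., g (n - 1)\<close> run one after another on cells of length
  \<open>1 / n\<close>. Time and space shrink by the same factor, so difference quotients within a
  cell are those of the single path. Clamping freezes each path at its end points outside its own
  cell.\<close>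

definition concat_path :: "nat \<Rightarrow> (nat \<Rightarrow> real \<Rightarrow> 'b::real_vector) \<Rightarrow> real \<Rightarrow> 'b" where
  "concat_path n g t = (\<Sum>i<n. g i (max 0 (min 1 (real n * t - real i)))) /\<^sub>R real n"

text \<open>On cell \<open>i\<close> the earlier paths are finished and contribute
  \<open>g j 1\<close>, while the later ones still rest at \<open>g j 0 = 0\<close>.\<close>

lemma concat_path_cell:
  assumes i: "i < n" and u: "0 \<le> u" "u \<le> 1" and zero: "\<And>j. j < n \<Longrightarrow> g j 0 = 0"
  shows "concat_path n g ((real i + u) / real n) = ((\<Sum>j<i. g j 1) + g i u) /\<^sub>R real n"
proof -
  have n: "real n * ((real i + u) / real n) = real i + u" using i by simp
  have "(\<Sum>j<n. g j (max 0 (min 1 (real i + u - real j)))) =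
      (\<Sum>j\<in>{..<i} \<union> {i} \<union> {Suc i..<n}. g j (max 0 (min 1 (real i + u - real j))))"
    using i by (intro sum.cong) auto
  also have "\<dots> = (\<Sum>j<i. g j (max 0 (min 1 (real i + u - real j)))) + g i u
      + (\<Sum>j\<in>{Suc i..<n}. g j (max 0 (min 1 (real i + u - real j))))"
    using u by (subst sum.union_disjoint, auto)+
  also have "(\<Sum>j<i. g j (max 0 (min 1 (real i + u - real j)))) = (\<Sum>j<i. g j 1)"
  proof (rule sum.cong[OF refl])
    fix j assume "j \<in> {..<i}"
    then have "real j + 1 \<le> real i" by simp
    with u have "max 0 (min 1 (real i + u - real j)) = 1" by simp
    then show "g j (max 0 (min 1 (real i + u - real j))) = g j 1" by simp
  qed
  also have "(\<Sum>j\<in>{Suc i..<n}. g j (max 0 (min 1 (real i + u - real j)))) = 0"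
  proof (rule sum.neutral, rule ballI)
    fix j assume j: "j \<in> {Suc i..<n}"
    then have "real i + 1 \<le> real j" by simp
    with u have "max 0 (min 1 (real i + u - real j)) = 0" by simp
    with zero j show "g j (max 0 (min 1 (real i + u - real j))) = 0" by simp
  qed
  finally show ?thesis by (simp add: concat_path_def n)
qed

lemma scale_concat_path_cell:
  assumes "i < n" "0 \<le> u" "u \<le> 1" "\<And>j. j < n \<Longrightarrow> g j 0 = 0"
  shows "real n *\<^sub>R concat_path n g ((real i + u) / real n) = (\<Sum>j<i. g j 1) + g i u"
  using concat_path_cell[of i n u g] assms by simp

text \<open>An increment between different cells consists of the rest of cell \<open>i\<close>, the
  complete cells strictly between, and the beginning of cell \<open>j\<close>.\<close>

lemma concat_path_diff:
  assumes ij: "i < j" "j < n" and u: "0 \<le> u" "u \<le> 1" and v: "0 \<le> v" "v \<le> 1"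
    and zero: "\<And>j. j < n \<Longrightarrow> g j 0 = 0"
  shows "real n *\<^sub>R (concat_path n g ((real j + v) / real n) - concat_path n g ((real i + u) / real n)) =
    (g i 1 - g i u) + (\<Sum>k\<in>{Suc i..<j}. g k 1) + g j v"
proof -
  have "(\<Sum>k<j. g k 1) = (\<Sum>k<Suc i. g k 1) + (\<Sum>k\<in>{Suc i..<j}. g k 1)"
    unfolding lessThan_atLeast0 using ij by (intro sum.atLeastLessThan_concat[symmetric]) auto
  then show ?thesis
    using scale_concat_path_cell[of i n u g] scale_concat_path_cell[of j n v g] ij u v zero
    by (simp add: scaleR_diff_right)
qed

lemma concat_path_diff_same:
  assumes "i < n" and u: "0 \<le> u" "u \<le> 1" and v: "0 \<le> v" "v \<le> 1"
    and zero: "\<And>j. j < n \<Longrightarrow> g j 0 = 0"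
  shows "real n *\<^sub>R (concat_path n g ((real i + v) / real n) - concat_path n g ((real i + u) / real n)) =
    g i v - g i u"
  using scale_concat_path_cell[of i n u g] scale_concat_path_cell[of i n v g] assms
  by (simp add: scaleR_diff_right)

lemma unit_interval_cell:
  assumes "n > 0" "0 \<le> t" "t \<le> 1"
  obtains i u where "i < n" "0 \<le> u" "u \<le> 1" "t = (real i + u) / real n"
proof (cases "t = 1")
  case True
  \<comment> \<open>The right end point belongs to the last cell with \<open>u = 1\<close>; taking
    the floor would give the index \<open>n\<close>.\<close>
  then show ?thesis using assms that[of "n - 1" 1] by (simp add: of_nat_diff)
next
  case False
  define i where "i = nat \<lfloor>real n * t\<rfloor>"
  have nn: "0 \<le> real n * t" using assms by simp
  then have i: "real i \<le> real n * t" "real n * t < real i + 1" unfolding i_def by linarith+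
  have "real n * t < real n" using assms False by simp
  with i have "i < n" by linarith
  with i assms show ?thesis using that[of i "real n * t - real i"] by simp
qed

lemma unit_interval_cells:
  assumes "n > 0" "0 \<le> s" "s < t" "t \<le> 1"
  obtains i u j v where "i \<le> j" "j < n" "0 \<le> u" "u \<le> 1" "s = (real i + u) / real n"
    "0 \<le> v" "v \<le> 1" "t = (real j + v) / real n"
proof -
  obtain i u where i: "i < n" "0 \<le> u" "u \<le> 1" "s = (real i + u) / real n"
    using unit_interval_cell[of n s] assms by (metis less_imp_le order_trans)
  obtain j v where j: "j < n" "0 \<le> v" "v \<le> 1" "t = (real j + v) / real n"
    using unit_interval_cell[of n t] assms by (metis less_imp_le order_trans)
  have "real i + u < real j + v" using assms(1,3) i(4) j(4) by (simp add: divide_less_cancel)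
  then have "i \<le> j" using i j by linarith
  with i j that show ?thesis by blast
qed

section \<open>Scale-invariant estimates for concatenated paths\<close>

context p_exponent
begin

text \<open>Both sides pick up the factor \<open>r powr p\<close>. Estimates may therefore be proved
  after magnifying a cell to unit length.\<close>

lemma pn_le_rescale:
  assumes "r > 0" "a \<ge> 0"
  shows "pn (r *\<^sub>R x) \<le> c * (r * a) powr p \<longleftrightarrow> pn x \<le> c * a powr p"
proof -
  have "r powr p > 0" using assms by simp
  then show ?thesis using assms by (simp add: pn_scale powr_mult mult.left_commute[of c])
qed

lemma powr_le_one: "0 \<le> a \<Longrightarrow> a \<le> 1 \<Longrightarrow> a powr p \<le> 1"
  using p_pos powr_mono2[of p a 1] by simp

lemma powr_mono_p: "0 \<le> a \<Longrightarrow> a \<le> b \<Longrightarrow> a powr p \<le> b powr p"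
  using p_pos by (intro powr_mono2) auto

text \<open>The constants are tuned to concatenation: \<open>end_const * gain = 2\<close> matches
  the bound 2 for blocks of complete cells, and \<open>lip_const\<close> pays for two partial cells
  and one such block.\<close>

definition gain :: real where "gain = 1 - 2 powr (- p)"
definition end_const :: real where "end_const = 2 / gain"
definition lip_const :: real where "lip_const = 2 * end_const + 2"

lemma gain_pos: "0 < gain" and gain_le_1: "gain \<le> 1"
  using p_pos powr_less_mono[of "- p" 0 2] by (auto simp: gain_def)

lemma end_const_ge_1: "1 \<le> end_const" and lip_const_ge_1: "1 \<le> lip_const"
  using gain_pos gain_le_1 by (auto simp: end_const_def lip_const_def field_simps)

text \<open>A partial reversal of the subadditivity of \<open>a powr p\<close>. If
  \<open>k \<le> 2 * u\<close>, replace \<open>k\<close> by \<open>2 * u\<close>; the left side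
  becomes \<open>(2 * u) powr p\<close>, and \<open>2 * u \<le> k + u\<close>. Otherwise
  \<open>u powr p \<le> (k / 2) powr p\<close>, which is exactly what \<open>gain\<close> removes
  from \<open>k powr p\<close>.\<close>

lemma powr_add_gain:
  assumes k: "1 \<le> k" and u: "0 \<le> u" "u \<le> 1"
  shows "gain * k powr p + u powr p \<le> (k + u) powr p"
proof -
  have half: "(a / 2) powr p = a powr p * 2 powr (- p)" if "a \<ge> 0" for a
    using that by (simp add: powr_divide powr_minus_divide)
  show ?thesis
  proof (cases "k \<le> 2 * u")
    case True
    have "gain * k powr p \<le> gain * (2 * u) powr p"
      using True k u gain_pos by (intro mult_left_mono powr_mono_p) auto
    moreover have "gain * (2 * u) powr p = (2 * u) powr p - u powr p"
      using half[of "2 * u"] u by (simp add: gain_def algebra_simps)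
    moreover have "(2 * u) powr p \<le> (k + u) powr p" using k u True by (intro powr_mono_p) auto
    ultimately show ?thesis by linarith
  next
    case False
    then have "u powr p \<le> (k / 2) powr p" using u by (intro powr_mono_p) auto
    moreover have "(k / 2) powr p = k powr p - gain * k powr p"
      using half[of k] k by (simp add: gain_def algebra_simps)
    moreover have "k powr p \<le> (k + u) powr p" using k u by (intro powr_mono_p) auto
    ultimately show ?thesis by linarith
  qed
qed

text \<open>This lets \<open>k\<close> complete cells followed by a partial one be absorbed into the
  same constant \<open>end_const\<close>.\<close>

lemma end_const_step:
  assumes "1 \<le> k" "0 \<le> u" "u \<le> 1"
  shows "2 * k powr p + end_const * u powr p \<le> end_const * (k + u) powr p"
  using mult_left_mono[OF powr_add_gain[OF assms], of end_const] end_const_ge_1 gain_pos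
  by (simp add: end_const_def algebra_simps)

text \<open>
  Concatenation must not worsen any of the constants. A difference across a node is the sum of two
  differences starting at an end point, which are controlled by a smaller constant than the
  interior ones: \<^const>\<open>end_const\<close> against \<^const>\<open>lip_const\<close> globally, and \<open>e\<close> against \<open>2 * e\<close> locally.
\<close>

definition locally_small :: "real \<Rightarrow> (real \<Rightarrow> 'a) \<Rightarrow> real \<Rightarrow> bool" where
  "locally_small e G \<eta> \<longleftrightarrow>
    (\<forall>u. 0 \<le> u \<longrightarrow> u \<le> \<eta> \<longrightarrow> pn (G u) \<le> e * u powr p \<and> pn (G 1 - G (1 - u)) \<le> e * u powr p) \<and>
    (\<forall>u v. 0 \<le> u \<longrightarrow> u \<le> v \<longrightarrow> v \<le> 1 \<longrightarrow> v - u \<le> \<eta> \<longrightarrow> pn (G v - G u) \<le> 2 * e * (v - u) powr p)"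

definition tame :: "(real \<Rightarrow> 'a) \<Rightarrow> bool" where
  "tame G \<longleftrightarrow> G 0 = 0 \<and>
    (\<forall>u. 0 \<le> u \<longrightarrow> u \<le> 1 \<longrightarrow>
      pn (G u) \<le> end_const * u powr p \<and> pn (G 1 - G u) \<le> end_const * (1 - u) powr p) \<and>
    (\<forall>u v. 0 \<le> u \<longrightarrow> u \<le> v \<longrightarrow> v \<le> 1 \<longrightarrow> pn (G v - G u) \<le> lip_const * (v - u) powr p)"

lemma pn_add3: "pn (x + y + z) \<le> pn x + pn y + pn z"
  using pn_add[of "x + y" z] pn_add[of x y] by simp

text \<open>An increment from an end point is a block of complete cells plus one partial cell, which
  \<open>end_const_step\<close> handles. An increment across a node is two partial cells plus a
  block, and the three costs add up to \<open>lip_const\<close>. Within one cell the bound of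
  \<open>g i\<close> is inherited.\<close>

lemma tame_concat:
  assumes n: "n > 0" and tame: "\<And>i. i < n \<Longrightarrow> tame (g i)"
    and blocks: "\<And>i j. i < j \<Longrightarrow> j \<le> n \<Longrightarrow> pn (\<Sum>k\<in>{i..<j}. g k 1) \<le> 2 * real (j - i) powr p"
  shows "tame (concat_path n g)"
proof -
  let ?H = "concat_path n g"
  have zero: "g i 0 = 0" if "i < n" for i using tame[OF that] by (simp add: tame_def)
  have blocks': "pn (\<Sum>k\<in>{i..<j}. g k 1) \<le> 2 * real (j - i) powr p" if "i \<le> j" "j \<le> n" for i j
    using blocks[of i j] that by (cases "i = j") auto
  have H0: "?H 0 = 0" using concat_path_cell[of 0 n 0 g] n zero by simp
  have H1: "?H 1 = (\<Sum>k<n. g k 1) /\<^sub>R real n"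
  proof -
    have "(\<Sum>k<n. g k 1) = (\<Sum>k<n - 1. g k 1) + g (n - 1) 1"
      using n by (metis Suc_diff_1 sum.lessThan_Suc)
    then show ?thesis using concat_path_cell[of "n - 1" n 1 g] n zero by (simp add: of_nat_diff)
  qed
  have start: "pn (?H t) \<le> end_const * t powr p" and stop: "pn (?H 1 - ?H t) \<le> end_const * (1 - t) powr p"
    if t: "0 \<le> t" "t \<le> 1" for t
  proof -
    obtain i u where i: "i < n" "0 \<le> u" "u \<le> 1" "t = (real i + u) / real n"
      using unit_interval_cell[OF n t] .
    have g: "pn (g i u) \<le> end_const * u powr p" "pn (g i 1 - g i u) \<le> end_const * (1 - u) powr p"
      using tame[OF i(1)] i by (auto simp: tame_def)
    have nt: "real n * t = real i + u" using i n by simp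
    have "real n *\<^sub>R ?H t = (\<Sum>k\<in>{0..<i}. g k 1) + g i u"
      using scale_concat_path_cell[of i n u g] i zero by (simp add: lessThan_atLeast0)
    then have "pn (real n *\<^sub>R ?H t) \<le> 2 * real i powr p + end_const * u powr p"
      using pn_add[of "\<Sum>k\<in>{0..<i}. g k 1" "g i u"] blocks'[of 0 i] i g by simp
    also have "\<dots> \<le> end_const * (real n * t) powr p"
      using end_const_step[of "real i" u] i by (cases "i = 0") (auto simp: nt)
    finally show "pn (?H t) \<le> end_const * t powr p"
      using pn_le_rescale[of "real n" t] n t by simp
    have "(\<Sum>k<n. g k 1) = (\<Sum>k<Suc i. g k 1) + (\<Sum>k\<in>{Suc i..<n}. g k 1)"
      unfolding lessThan_atLeast0 using i by (intro sum.atLeastLessThan_concat[symmetric]) auto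
    then have "real n *\<^sub>R (?H 1 - ?H t) = (\<Sum>k\<in>{Suc i..<n}. g k 1) + (g i 1 - g i u)"
      using scale_concat_path_cell[of i n u g] i zero n by (simp add: H1 scaleR_diff_right)
    then have "pn (real n *\<^sub>R (?H 1 - ?H t)) \<le> 2 * real (n - Suc i) powr p + end_const * (1 - u) powr p"
      using pn_add[of "\<Sum>k\<in>{Suc i..<n}. g k 1" "g i 1 - g i u"] blocks'[of "Suc i" n] i g by simp
    also have "\<dots> \<le> end_const * (real (n - Suc i) + (1 - u)) powr p"
      using end_const_step[of "real (n - Suc i)" "1 - u"] i by (cases "n - Suc i = 0") auto
    also have "real (n - Suc i) + (1 - u) = real n * (1 - t)"
      using i nt by (simp add: of_nat_diff algebra_simps)
    finally show "pn (?H 1 - ?H t) \<le> end_const * (1 - t) powr p"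
      using pn_le_rescale[of "real n" "1 - t"] n t by simp
  qed
  have lip: "pn (?H t - ?H s) \<le> lip_const * (t - s) powr p" if st: "0 \<le> s" "s \<le> t" "t \<le> 1" for s t
  proof (cases "s = t")
    case False
    with st have "s < t" by simp
    obtain i u j v where ij: "i \<le> j" "j < n" and u: "0 \<le> u" "u \<le> 1" "s = (real i + u) / real n"
      and v: "0 \<le> v" "v \<le> 1" "t = (real j + v) / real n"
      using unit_interval_cells[OF n st(1) \<open>s < t\<close> st(3)] .
    have nts: "real n * (t - s) = (real j + v) - (real i + u)"
      using n by (simp add: u(3) v(3) right_diff_distrib)
    have "pn (real n *\<^sub>R (?H t - ?H s)) \<le> lip_const * (real n * (t - s)) powr p"
    proof (cases "i = j")
      case True
      have "real n * (t - s) > 0" using \<open>s < t\<close> n by simp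
      then have "u \<le> v" "real n * (t - s) = v - u" using True nts by auto
      moreover have "real n *\<^sub>R (?H t - ?H s) = g j v - g j u"
        using True u v ij zero by (simp add: concat_path_diff_same)
      ultimately show ?thesis using tame[OF ij(2)] u v by (simp add: tame_def)
    next
      case False
      with ij have "i < j" by simp
      have g: "pn (g i 1 - g i u) \<le> end_const * (1 - u) powr p" "pn (g j v) \<le> end_const * v powr p"
        using tame[of i] tame[of j] \<open>i < j\<close> ij u v by (auto simp: tame_def)
      have b: "pn (\<Sum>k\<in>{Suc i..<j}. g k 1) \<le> 2 * real (j - Suc i) powr p"
        using blocks'[of "Suc i" j] \<open>i < j\<close> ij by simp
      have len: "real n * (t - s) = (1 - u) + real (j - Suc i) + v"
        using nts \<open>i < j\<close> by (simp add: of_nat_diff)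
      have "pn (real n *\<^sub>R (?H t - ?H s)) \<le> pn (g i 1 - g i u) + pn (\<Sum>k\<in>{Suc i..<j}. g k 1) + pn (g j v)"
        using concat_path_diff[of i j n u v g] \<open>i < j\<close> ij u v zero pn_add3 by simp
      also have "\<dots> \<le> end_const * (1 - u) powr p + 2 * real (j - Suc i) powr p + end_const * v powr p"
        using g b by linarith
      also have "\<dots> \<le> end_const * (real n * (t - s)) powr p + 2 * (real n * (t - s)) powr p
          + end_const * (real n * (t - s)) powr p"
        unfolding len using u v end_const_ge_1 by (intro add_mono mult_left_mono powr_mono_p) auto
      also have "\<dots> = lip_const * (real n * (t - s)) powr p"
        by (simp add: lip_const_def algebra_simps)
      finally show ?thesis .
    qed
    then show ?thesis using pn_le_rescale[of "real n" "t - s"] n st by simp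
  qed simp
  from H0 start stop lip show ?thesis unfolding tame_def by blast
qed

text \<open>An increment of length at most \<open>\<eta> / n\<close> meets at most two cells,
  because \<open>\<eta> \<le> 1/2\<close>. If it crosses a node, it is a sum of two end increments
  with constant \<open>e\<close> each, hence \<open>2 * e\<close>; near 0 or 1 it stays in the first
  or last cell.\<close>

lemma locally_small_concat:
  assumes n: "n > 0" and zero: "\<And>i. i < n \<Longrightarrow> g i 0 = 0"
    and small: "\<And>i. i < n \<Longrightarrow> locally_small e (g i) \<eta>" and \<eta>: "0 < \<eta>" "\<eta> \<le> 1/2" and e: "e \<ge> 0"
  shows "locally_small e (concat_path n g) (\<eta> / real n)"
  unfolding locally_small_def
proof (intro conjI allI impI)
  let ?H = "concat_path n g"
  have H1: "?H 1 = ((\<Sum>k<n - 1. g k 1) + g (n - 1) 1) /\<^sub>R real n"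
    using concat_path_cell[of "n - 1" n 1 g] n zero by (simp add: of_nat_diff)
  fix u assume u: "0 \<le> u" "u \<le> \<eta> / real n"
  have nu: "0 \<le> real n * u" "real n * u \<le> \<eta>" using u n by (auto simp: field_simps)
  have "real n *\<^sub>R ?H u = g 0 (real n * u)"
    using concat_path_cell[of 0 n "real n * u" g] n nu \<eta> zero by simp
  moreover have "pn (g 0 (real n * u)) \<le> e * (real n * u) powr p"
    using small[of 0] n nu by (simp add: locally_small_def)
  ultimately have "pn (real n *\<^sub>R ?H u) \<le> e * (real n * u) powr p" by simp
  then show "pn (?H u) \<le> e * u powr p"
    using pn_le_rescale[of "real n" u] n u by simp
  have "1 - u = (real (n - 1) + (1 - real n * u)) / real n"
    using n by (simp add: of_nat_diff field_simps)
  then have "?H (1 - u) = ((\<Sum>k<n - 1. g k 1) + g (n - 1) (1 - real n * u)) /\<^sub>R real n"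
    using concat_path_cell[of "n - 1" n "1 - real n * u" g] n nu \<eta> zero by simp
  then have "real n *\<^sub>R (?H 1 - ?H (1 - u)) = g (n - 1) 1 - g (n - 1) (1 - real n * u)"
    using n by (simp add: H1 scaleR_diff_right)
  moreover have "pn (g (n - 1) 1 - g (n - 1) (1 - real n * u)) \<le> e * (real n * u) powr p"
    using small[of "n - 1"] n nu by (simp add: locally_small_def)
  ultimately have "pn (real n *\<^sub>R (?H 1 - ?H (1 - u))) \<le> e * (real n * u) powr p" by simp
  then show "pn (?H 1 - ?H (1 - u)) \<le> e * u powr p"
    using pn_le_rescale[of "real n" u] n u by simp
next
  let ?H = "concat_path n g"
  fix s t assume st: "0 \<le> s" "s \<le> t" "t \<le> 1" "t - s \<le> \<eta> / real n"
  show "pn (?H t - ?H s) \<le> 2 * e * (t - s) powr p"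
  proof (cases "s = t")
    case False
    with st have "s < t" by simp
    obtain i u j v where ij: "i \<le> j" "j < n" and u: "0 \<le> u" "u \<le> 1" "s = (real i + u) / real n"
      and v: "0 \<le> v" "v \<le> 1" "t = (real j + v) / real n"
      using unit_interval_cells[OF n st(1) \<open>s < t\<close> st(3)] .
    have nts: "real n * (t - s) = (real j + v) - (real i + u)"
      using n by (simp add: u(3) v(3) right_diff_distrib)
    have le: "real n * (t - s) \<le> \<eta>" using st n by (simp add: field_simps)
    have "pn (real n *\<^sub>R (?H t - ?H s)) \<le> 2 * e * (real n * (t - s)) powr p"
    proof (cases "i = j")
      case True
      have "real n * (t - s) > 0" using \<open>s < t\<close> n by simp
      then have "u \<le> v" "real n * (t - s) = v - u" using True nts by auto
      moreover have "real n *\<^sub>R (?H t - ?H s) = g j v - g j u"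
        using True u v ij zero by (simp add: concat_path_diff_same)
      ultimately show ?thesis using small[OF ij(2)] u v le by (simp add: locally_small_def)
    next
      case False
      have j: "j = Suc i"
      proof -
        have "real j \<le> real i + 1/2 + u" using nts le \<eta> v by linarith
        then have "real j < real i + 2" using u by linarith
        with ij False show ?thesis by linarith
      qed
      have len: "real n * (t - s) = (1 - u) + v" using nts j by simp
      have g: "pn (g i 1 - g i u) \<le> e * (1 - u) powr p"
      proof -
        have "1 - u \<le> \<eta>" using len le v by linarith
        then have "pn (g i 1 - g i (1 - (1 - u))) \<le> e * (1 - u) powr p"
          using small[of i] ij j u unfolding locally_small_def by (meson Suc_lessD diff_ge_0_iff_ge)
        then show ?thesis by simp
      qed
      have g': "pn (g j v) \<le> e * v powr p"
        using small[OF ij(2)] len le u v unfolding locally_small_def by auto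
      have "real n *\<^sub>R (?H t - ?H s) = (g i 1 - g i u) + g j v"
        using concat_path_diff[of i j n u v g] ij u v zero j by simp
      then have "pn (real n *\<^sub>R (?H t - ?H s)) \<le> e * (1 - u) powr p + e * v powr p"
        using pn_add[of "g i 1 - g i u" "g j v"] g g' by simp
      also have "\<dots> \<le> e * (real n * (t - s)) powr p + e * (real n * (t - s)) powr p"
        unfolding len using u v e by (intro add_mono mult_left_mono powr_mono_p) auto
      finally show ?thesis by simp
    qed
    then show ?thesis using pn_le_rescale[of "real n" "t - s"] n st by simp
  qed simp
qed

lemma locally_small_mono: "locally_small e G \<eta> \<Longrightarrow> \<eta>' \<le> \<eta> \<Longrightarrow> locally_small e G \<eta>'"
  unfolding locally_small_def by (meson order_trans)

section \<open>End points of tame paths with small local velocity\<close>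

definition reachable :: "real \<Rightarrow> 'a \<Rightarrow> bool" where
  "reachable e x \<longleftrightarrow> (\<exists>G \<eta>. tame G \<and> 0 < \<eta> \<and> \<eta> \<le> 1/2 \<and> locally_small e G \<eta> \<and> G 1 = x)"

text \<open>Concatenating paths to the \<open>x i\<close> gives a path to their average. The
  constants of \<open>tame\<close> and \<open>e\<close> survive; only the scale shrinks, to the
  smallest \<open>\<eta> i\<close> divided by \<open>n\<close>.\<close>

lemma reachable_average:
  assumes n: "n > 0" and e: "e \<ge> 0" and x: "\<And>i. i < n \<Longrightarrow> reachable e (x i)"
    and blocks: "\<And>i j. i < j \<Longrightarrow> j \<le> n \<Longrightarrow> pn (\<Sum>k\<in>{i..<j}. x k) \<le> 2 * real (j - i) powr p"
  shows "reachable e ((\<Sum>k<n. x k) /\<^sub>R real n)"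
proof -
  obtain g \<eta> where g: "\<And>i. i < n \<Longrightarrow> tame (g i) \<and> 0 < \<eta> i \<and> \<eta> i \<le> 1/2 \<and>
      locally_small e (g i) (\<eta> i) \<and> g i 1 = x i"
    using x unfolding reachable_def by metis
  define \<eta>0 where "\<eta>0 = Min (\<eta> ` {..<n})"
  have \<eta>0: "0 < \<eta>0" "\<eta>0 \<le> \<eta> i" if "i < n" for i
  proof -
    have "\<eta>0 \<in> \<eta> ` {..<n}" unfolding \<eta>0_def using n by (intro Min_in) auto
    then show "0 < \<eta>0" using g by auto
    show "\<eta>0 \<le> \<eta> i" unfolding \<eta>0_def using that by (intro Min_le) auto
  qed
  have \<eta>1: "0 < \<eta>0" "\<eta>0 \<le> 1/2" using \<eta>0[OF n] g[OF n] by auto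
  have zero: "g i 0 = 0" if "i < n" for i using g[OF that] by (simp add: tame_def)
  have "tame (concat_path n g)"
  proof (rule tame_concat[OF n])
    fix i j assume ij: "i < j" "j \<le> n"
    then have "(\<Sum>k\<in>{i..<j}. g k 1) = (\<Sum>k\<in>{i..<j}. x k)" using g by (intro sum.cong) auto
    with blocks[OF ij] show "pn (\<Sum>k\<in>{i..<j}. g k 1) \<le> 2 * real (j - i) powr p" by simp
  qed (use g in blast)
  moreover have "locally_small e (concat_path n g) (\<eta>0 / real n)"
  proof (rule locally_small_concat)
    fix i assume "i < n"
    then show "locally_small e (g i) \<eta>0"
      using locally_small_mono[of e "g i" "\<eta> i" \<eta>0] g \<eta>0 by simp
  qed (use n zero \<eta>1 e in auto)
  moreover have "concat_path n g 1 = (\<Sum>k<n. x k) /\<^sub>R real n"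
  proof -
    have "concat_path n g 1 = ((\<Sum>k<n - 1. g k 1) + g (n - 1) 1) /\<^sub>R real n"
      using concat_path_cell[of "n - 1" n 1 g] n zero by (simp add: of_nat_diff)
    also have "(\<Sum>k<n - 1. g k 1) + g (n - 1) 1 = (\<Sum>k<n. g k 1)"
      using n by (metis Suc_diff_1 sum.lessThan_Suc)
    also have "\<dots> = (\<Sum>k<n. x k)" using g by (intro sum.cong) auto
    finally show ?thesis .
  qed
  moreover have "\<eta>0 / real n \<le> 1/2"
    using \<eta>1 n mult_mono[of 1 "real n" "1/2" "1/2"] by (simp add: field_simps)
  moreover have "0 < \<eta>0 / real n" using \<eta>1 n by simp
  ultimately show ?thesis unfolding reachable_def by blast
qed

text \<open>The straight path works: its Lipschitz bound \<open>pn y\<close> is below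
  \<open>e\<close>, and \<open>e \<le> 1\<close> is below the constants of
  \<open>tame\<close>.\<close>

lemma reachable_small:
  assumes "pn y \<le> e" "e \<le> 1"
  shows "reachable e y"
proof -
  have e: "0 \<le> e" using assms pn_nonneg[of y] by linarith
  have le: "pn (u *\<^sub>R y) \<le> c * u powr p" if "e \<le> c" "0 \<le> u" for c u
    using assms that mult_right_mono[of "pn y" c "u powr p"] by (simp add: pn_scale mult.commute)
  have le': "pn (v *\<^sub>R y - u *\<^sub>R y) \<le> c * (v - u) powr p" if "e \<le> c" "u \<le> v" for c u v
    using le[of c "v - u"] that by (simp add: scaleR_left_diff_distrib)
  have "pn (y - u *\<^sub>R y) \<le> c * (1 - u) powr p" if "e \<le> c" "u \<le> 1" for c u
    using le'[of c u 1] that by simp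
  moreover have "pn (y - (1 - u) *\<^sub>R y) \<le> c * u powr p" if "e \<le> c" "0 \<le> u" for c u
    using le'[of c "1 - u" 1] that by simp
  ultimately have "tame (\<lambda>u. u *\<^sub>R y)" "locally_small e (\<lambda>u. u *\<^sub>R y) (1/2)"
    using assms e end_const_ge_1 lip_const_ge_1 le le' unfolding tame_def locally_small_def by simp_all
  then show ?thesis unfolding reachable_def
    by (intro exI[of _ "\<lambda>u. u *\<^sub>R y"] exI[of _ "1/2"]) simp
qed

end

section \<open>Paths with small velocity\<close>

locale trivial_dual_space = p_exponent p ty for p :: real and ty :: "'a::quasi_banach itself" +
  assumes trivial_dual:
    "\<And>\<phi> :: 'a \<Rightarrow> real. linear \<phi> \<Longrightarrow> continuous_on UNIV \<phi> \<Longrightarrow> \<phi> = (\<lambda>x. 0)"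
begin

text \<open>
  The multiples \<open>(j / q) x\<close> are reached by induction on \<open>j\<close>. Write \<open>x\<close> as the average of \<open>n\<close> small
  vectors \<open>y i\<close>. Then \<open>((j + 1) / q) x\<close> is the average over \<open>i < n\<close> of the averages of \<open>q\<close> copies of
  \<open>(j / q) x\<close> and one small multiple of \<open>y i\<close>. For \<open>n \<le> (q + 1) powr p\<close> the sums of consecutive
  \<open>y i\<close>, weighted by \<open>1 / (q + 1)\<close>, stay bounded.
\<close>

lemma reachable_unit:
  assumes x: "pn x \<le> 1" and e: "0 < e" "e \<le> 1"
  shows "reachable e x"
proof -
  obtain n z where n: "n > 0" and z: "(\<Sum>i<n. z i) = x"
    \<comment> \<open>The \<open>p\<close>-th power of this bound is \<open>e / 2\<close>.\<close>
    and zq: "\<And>i. i < n \<Longrightarrow> qnorm (real n *\<^sub>R z i) \<le> (e / 2) powr (1 / p)"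
    using small_average[OF trivial_dual, of "(e / 2) powr (1 / p)" x] e by auto
  have zs: "pn (real n *\<^sub>R z i) \<le> e / 2" if "i < n" for i
    using powr_mono_p[OF qnorm_nonneg zq[OF that]] e p_pos by (simp add: pn_def powr_powr)
  \<comment> \<open>Chosen so that \<open>n\<close> vectors of \<open>pn\<close> at most 1, weighted
    by \<open>1 / (q + 1)\<close>, have a sum of \<open>pn\<close> at most 1.\<close>
  obtain q :: nat where q: "real n powr (1 / p) \<le> real q"
    using real_arch_simple by blast
  have "1 \<le> real n powr (1 / p)" using n p_pos by (intro ge_one_powr_ge_zero) auto
  with q have "q > 0" by (cases q) auto
  have nq: "real n \<le> (real q + 1) powr p"
  proof -
    have "real n = (real n powr (1 / p)) powr p" using n p_pos by (simp add: powr_powr)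
    also have "\<dots> \<le> (real q + 1) powr p" using q by (intro powr_mono_p) auto
    finally show ?thesis .
  qed
  have scale_le: "pn (a *\<^sub>R x) \<le> b powr p" if "0 \<le> a" "a \<le> b" for a b
  proof -
    have "pn (a *\<^sub>R x) \<le> a powr p * 1"
      using that x by (simp add: pn_scale mult_left_le)
    also have "\<dots> \<le> b powr p" using powr_mono_p that by simp
    finally show ?thesis .
  qed
  have "j \<le> q \<Longrightarrow> reachable e ((real j / real q) *\<^sub>R x)" for j
  proof (induction j)
    case 0
    then show ?case using e by (simp add: reachable_small)
  next
    case (Suc j)
    define c where "c = real j / real q"
    define c' where "c' = (real j + 1) / real q"
    \<comment> \<open>The weight \<open>1 + c'\<close> makes the average come out exactly:
      \<open>q * c + 1 + c' = j + 1 + c' = (q + 1) * c'\<close>. Being at most 2, it only doubles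
      the bound \<open>e / 2\<close>.\<close>
    define y where "y i = (1 + c') *\<^sub>R (real n *\<^sub>R z i)" for i
    have c: "0 \<le> c" "c \<le> 1" "0 \<le> c'" "c' \<le> 1"
      using Suc.prems \<open>q > 0\<close> by (auto simp: c_def c'_def)
    have qc: "real q * c = real j" "real q * c' = real j + 1" using \<open>q > 0\<close> by (auto simp: c_def c'_def)
    have y: "pn (y i) \<le> e" if "i < n" for i
    proof -
      have "(1 + c') powr p \<le> 2"
        using powr_le_self[of "1 + c'"] c by simp
      then have "(1 + c') powr p * pn (real n *\<^sub>R z i) \<le> 2 * (e / 2)"
        using zs[OF that] by (intro mult_mono) auto
      with c show ?thesis by (simp add: y_def pn_scale del: scaleR_scaleR)
    qed
    have cx: "reachable e (c *\<^sub>R x)" using Suc by (simp add: c_def)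
    define w where "w i = (1 / (real q + 1)) *\<^sub>R ((real q * c) *\<^sub>R x + y i)" for i
    have "reachable e (w i)" if i: "i < n" for i
    proof -
      define X where "X k = (if k < q then c *\<^sub>R x else y i)" for k
      have sumX: "(\<Sum>k\<in>{a..<b}. X k) = (real (b - a) * c) *\<^sub>R x" if "b \<le> q" for a b
      proof -
        have "(\<Sum>k\<in>{a..<b}. X k) = (\<Sum>k\<in>{a..<b}. c *\<^sub>R x)"
          using that by (intro sum.cong) (auto simp: X_def)
        then show ?thesis by (simp add: sum_constant_scaleR)
      qed
      have le: "pn ((real (b - a) * c) *\<^sub>R x) \<le> real (b - a) powr p" for a b
        using c by (intro scale_le) (auto simp: mult_left_le)
      have "reachable e ((\<Sum>k<Suc q. X k) /\<^sub>R real (Suc q))"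
      proof (rule reachable_average)
        fix k show "reachable e (X k)"
          using cx reachable_small[OF y[OF i] e(2)] by (simp add: X_def)
      next
        fix a b assume ab: "a < b" "b \<le> Suc q"
        \<comment> \<open>The copies of \<open>c *\<^sub>R x\<close> contribute at most
          \<open>(b - a) powr p\<close> since \<open>pn x \<le> 1\<close>, and the single small
          vector at most \<open>e \<le> 1\<close>.\<close>
        show "pn (\<Sum>k\<in>{a..<b}. X k) \<le> 2 * real (b - a) powr p"
        proof (cases "b \<le> q")
          case True
          then show ?thesis using order_trans[OF le[of b a], of "2 * real (b - a) powr p"] by (simp add: sumX)
        next
          case False
          with ab have b: "b = Suc q" "a \<le> q" by auto
          have "pn (\<Sum>k\<in>{a..<b}. X k) \<le> pn ((real (q - a) * c) *\<^sub>R x) + pn (y i)"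
            using b sumX[of q a] pn_add by (simp add: X_def)
          also have "pn ((real (q - a) * c) *\<^sub>R x) \<le> real (b - a) powr p"
            using le[of q a] powr_mono_p[of "real (q - a)" "real (b - a)"] b by simp
          also have "pn (y i) \<le> real (b - a) powr p"
            using y[OF i] e powr_mono_p[of 1 "real (b - a)"] ab by simp
          finally show ?thesis by simp
        qed
      qed (use e in simp_all)
      moreover have "(\<Sum>k<Suc q. X k) = (real q * c) *\<^sub>R x + y i"
        using sumX[of q 0] by (simp add: X_def lessThan_atLeast0)
      ultimately show ?thesis by (simp add: w_def inverse_eq_divide add.commute)
    qed
    moreover have "pn (\<Sum>k\<in>{a..<b}. w k) \<le> 2 * real (b - a) powr p" if ab: "a < b" "b \<le> n" for a b
    proof -
      have eq: "(\<Sum>k\<in>{a..<b}. w k) = (real (b - a) * (real q * c / (real q + 1))) *\<^sub>R x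
          + (\<Sum>k\<in>{a..<b}. (1 / (real q + 1)) *\<^sub>R y k)"
        by (simp add: w_def scaleR_add_right sum.distrib sum_constant_scaleR)
      have "real q * c \<le> real q" using c by (simp add: mult_left_le)
      then have "real q * c / (real q + 1) \<le> 1" by (simp add: divide_le_eq)
      then have "real (b - a) * (real q * c / (real q + 1)) \<le> real (b - a)"
        by (intro mult_left_le) auto
      then have "pn ((real (b - a) * (real q * c / (real q + 1))) *\<^sub>R x) \<le> real (b - a) powr p"
        using c by (intro scale_le) auto
      moreover have "pn (\<Sum>k\<in>{a..<b}. (1 / (real q + 1)) *\<^sub>R y k) \<le> real (b - a) powr p"
      proof -
        have "pn (\<Sum>k\<in>{a..<b}. (1 / (real q + 1)) *\<^sub>R y k) \<le> (\<Sum>k\<in>{a..<b}. pn ((1 / (real q + 1)) *\<^sub>R y k))"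
          by (rule pn_sum)
        also have "\<dots> \<le> (\<Sum>k\<in>{a..<b}. 1 / (real q + 1) powr p)"
        proof (rule sum_mono)
          fix k assume "k \<in> {a..<b}"
          then have "pn (y k) \<le> 1" using y[of k] ab e by simp
          then show "pn ((1 / (real q + 1)) *\<^sub>R y k) \<le> 1 / (real q + 1) powr p"
            by (simp add: pn_scale powr_divide divide_right_mono)
        qed
        also have "\<dots> = real (b - a) / (real q + 1) powr p" by simp
        also have "\<dots> \<le> 1" using nq ab by (simp add: divide_le_eq)
        also have "1 \<le> real (b - a) powr p" using powr_mono_p[of 1 "real (b - a)"] ab by simp
        finally show ?thesis .
      qed
      ultimately show ?thesis unfolding eq by (smt (verit) pn_add)
    qed
    ultimately have "reachable e ((\<Sum>k<n. w k) /\<^sub>R real n)"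
      using n e by (intro reachable_average) auto
    moreover have "(\<Sum>k<n. w k) /\<^sub>R real n = c' *\<^sub>R x"
    proof -
      have "(\<Sum>k<n. y k) = (real n * (1 + c')) *\<^sub>R x"
        by (simp add: y_def z flip: scaleR_sum_right)
      then have "(\<Sum>k<n. w k) = (1 / (real q + 1)) *\<^sub>R ((real n * (real q * c)) *\<^sub>R x + (real n * (1 + c')) *\<^sub>R x)"
        by (simp add: w_def sum.distrib sum_constant_scaleR flip: scaleR_sum_right)
      also have "\<dots> = (1 / (real q + 1) * (real n * (real q * c + 1 + c'))) *\<^sub>R x"
        by (simp add: algebra_simps)
      also have "real q * c + 1 + c' = (real q + 1) * c'"
        using qc by (simp add: algebra_simps)
      also have "1 / (real q + 1) * (real n * ((real q + 1) * c')) = real n * c'"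
      proof -
        have "real q + 1 \<noteq> 0" by linarith
        then show ?thesis by simp
      qed
      finally show ?thesis using n by simp
    qed
    ultimately show ?case by (simp add: c'_def add.commute)
  qed
  from this[of q] \<open>q > 0\<close> show ?thesis by simp
qed

text \<open>Normalise \<open>x\<close> to quasi-norm 1, take its path from
  \<open>reachable_unit\<close>, and scale back; this multiplies the bounds by \<open>pn x\<close>.
  The zero vector gets the constant path.\<close>

lemma path_with_small_velocity:
  assumes e: "e > 0"
  obtains G \<eta> where "0 < \<eta>" "G 0 = 0" "G 1 = x"
    "\<And>u v. 0 \<le> u \<Longrightarrow> u \<le> v \<Longrightarrow> v \<le> 1 \<Longrightarrow> pn (G v - G u) \<le> lip_const * pn x * (v - u) powr p"
    "\<And>u v. 0 \<le> u \<Longrightarrow> u \<le> v \<Longrightarrow> v \<le> 1 \<Longrightarrow> v - u \<le> \<eta> \<Longrightarrow> pn (G v - G u) \<le> e * (v - u) powr p"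
proof (cases "x = 0")
  case True
  then show ?thesis using e by (intro that[of 1 "\<lambda>u. 0"]) auto
next
  case False
  then have q: "qnorm x > 0" using qnorm_nonneg[of x] qnorm_eq_zero[of x] by linarith
  then have pnx: "pn x > 0" by (simp add: pn_def)
  define x' where "x' = (1 / qnorm x) *\<^sub>R x"
  \<comment> \<open>Scaling back turns the interior constant \<open>2 * e'\<close> into
    \<open>pn x * (2 * e')\<close>, which is at most \<open>e\<close>.\<close>
  define e' where "e' = min 1 (e / (2 * pn x))"
  have "pn x' = 1" using q by (simp add: pn_def x'_def qnorm_scaleR)
  moreover have e': "0 < e'" "e' \<le> 1" "pn x * (2 * e') \<le> e"
    using e pnx by (auto simp: e'_def min_def field_simps)
  ultimately obtain G \<eta> where G: "tame G" "0 < \<eta>" "locally_small e' G \<eta>" "G 1 = x'"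
    using reachable_unit[of x' e'] unfolding reachable_def by auto
  have sc: "pn (qnorm x *\<^sub>R G v - qnorm x *\<^sub>R G u) = pn x * pn (G v - G u)" for u v
    using pn_scale[of "qnorm x" "G v - G u"] qnorm_nonneg[of x] by (simp add: pn_def scaleR_diff_right)
  show ?thesis
  proof (rule that[of \<eta> "\<lambda>u. qnorm x *\<^sub>R G u"])
    show "qnorm x *\<^sub>R G 0 = 0" "qnorm x *\<^sub>R G 1 = x" using G q by (auto simp: tame_def x'_def)
    fix u v :: real assume uv: "0 \<le> u" "u \<le> v" "v \<le> 1"
    then have "pn (G v - G u) \<le> lip_const * (v - u) powr p" using G by (simp add: tame_def)
    from mult_left_mono[OF this, of "pn x"]
    show "pn (qnorm x *\<^sub>R G v - qnorm x *\<^sub>R G u) \<le> lip_const * pn x * (v - u) powr p"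
      by (simp add: sc mult_ac)
    assume "v - u \<le> \<eta>"
    then have "pn (G v - G u) \<le> 2 * e' * (v - u) powr p" using G uv by (simp add: locally_small_def)
    from mult_left_mono[OF this, of "pn x"]
    have "pn (qnorm x *\<^sub>R G v - qnorm x *\<^sub>R G u) \<le> (pn x * (2 * e')) * (v - u) powr p"
      by (simp add: sc mult_ac)
    also have "\<dots> \<le> e * (v - u) powr p" using e' by (intro mult_right_mono) auto
    finally show "pn (qnorm x *\<^sub>R G v - qnorm x *\<^sub>R G u) \<le> e * (v - u) powr p" .
  qed (rule G)
qed

end

section \<open>Approximate primitives\<close>

context p_exponent
begin

text \<open>Equivalently, on all sufficiently short intervals the difference quotient differs from
  the value of \<open>f\<close> at the left end by at most \<open>\<delta>\<close> in
  \<open>pn\<close>.\<close>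

definition almost_primitive :: "(real \<Rightarrow> 'a) \<Rightarrow> real \<Rightarrow> (real \<Rightarrow> 'a) \<Rightarrow> bool" where
  "almost_primitive f \<delta> S \<longleftrightarrow> (\<exists>\<eta>>0. \<forall>s t. 0 \<le> s \<longrightarrow> s \<le> t \<longrightarrow> t \<le> 1 \<longrightarrow> t - s \<le> \<eta> \<longrightarrow>
    pn (S t - S s - (t - s) *\<^sub>R f s) \<le> \<delta> * (t - s) powr p)"

lemma uniform_oscillation:
  fixes f :: "real \<Rightarrow> 'a"
  assumes f: "continuous_on {0..1} f" and e: "e > 0"
  obtains \<eta> where "\<eta> > 0"
    "\<And>s t. 0 \<le> s \<Longrightarrow> s \<le> t \<Longrightarrow> t \<le> 1 \<Longrightarrow> t - s \<le> \<eta> \<Longrightarrow> pn (f s - f t) \<le> e"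
proof -
  have "uniformly_continuous_on {0..1} f"
    using f by (intro compact_uniformly_continuous) auto
  then obtain d where d: "d > 0"
    "\<And>s t. s \<in> {0..1} \<Longrightarrow> t \<in> {0..1} \<Longrightarrow> dist s t < d \<Longrightarrow> dist (f s) (f t) < e"
    unfolding uniformly_continuous_on_def using e by (metis dist_commute)
  show ?thesis
    by (rule that[of "d / 2"]) (use d in \<open>auto simp: dist_pn[symmetric] dist_real_def intro!: less_imp_le\<close>)
qed

lemma pn_scaled_le: "pn x \<le> c \<Longrightarrow> 0 \<le> a \<Longrightarrow> pn (a *\<^sub>R x) \<le> c * a powr p"
  using mult_right_mono[of "pn x" c "a powr p"] by (simp add: pn_scale mult.commute)

end

context trivial_dual_space
begin

text \<open>\<open>lip_const + 2\<close> bounds the change inside one cell; the factor 2 accounts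
  for the two partial cells at the ends of an interval.\<close>

definition step_const :: real where "step_const = 2 * (lip_const + 2)"

text \<open>The new function agrees with \<open>S\<close> at the nodes, so \<open>S' - S\<close> is
  estimated cell by cell. Its bound depends on \<open>\<delta>\<close> but not on
  \<open>\<delta>'\<close>, so the corrections are summable when the errors decrease
  geometrically.\<close>

lemma improve_almost_primitive:
  assumes f: "continuous_on {0..1} f" and S: "almost_primitive f \<delta> S" "S 0 = 0"
    and pos: "\<delta> > 0" "\<delta>' > 0"
  shows "\<exists>S'. (S' 0 = 0 \<and> almost_primitive f \<delta>' S') \<and>
    (\<forall>s t. 0 \<le> s \<longrightarrow> s \<le> t \<longrightarrow> t \<le> 1 \<longrightarrow>
      pn ((S' t - S t) - (S' s - S s)) \<le> step_const * \<delta> * (t - s) powr p)"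
proof -
  obtain \<eta>S where \<eta>S: "\<eta>S > 0" "\<And>s t. 0 \<le> s \<Longrightarrow> s \<le> t \<Longrightarrow> t \<le> 1 \<Longrightarrow> t - s \<le> \<eta>S \<Longrightarrow>
      pn (S t - S s - (t - s) *\<^sub>R f s) \<le> \<delta> * (t - s) powr p"
    using S(1) unfolding almost_primitive_def by blast
  \<comment> \<open>\<open>\<epsilon> \<le> \<delta>\<close> absorbs the oscillation of
    \<open>f\<close> into the bound for \<open>S' - S\<close>. With \<open>\<delta>' / 8\<close>,
    the slow path and the oscillation together stay below \<open>\<delta>' / 4\<close>, leaving room
    for three such errors across a node.\<close>
  define \<epsilon> where "\<epsilon> = min \<delta> (\<delta>' / 8)"
  have \<epsilon>: "\<epsilon> > 0" "\<epsilon> \<le> \<delta>" "\<epsilon> \<le> \<delta>' / 8" using pos by (auto simp: \<epsilon>_def)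
  obtain \<eta>f where \<eta>f: "\<eta>f > 0"
    "\<And>s t. 0 \<le> s \<Longrightarrow> s \<le> t \<Longrightarrow> t \<le> 1 \<Longrightarrow> t - s \<le> \<eta>f \<Longrightarrow> pn (f s - f t) \<le> \<epsilon>"
    using uniform_oscillation[OF f \<epsilon>(1)] by blast
  obtain n where n: "n > 0" "1 / real n \<le> \<eta>S" "1 / real n \<le> \<eta>f"
  proof -
    obtain m where "inverse (real (Suc m)) < min \<eta>S \<eta>f"
      using reals_Archimedean[of "min \<eta>S \<eta>f"] \<eta>S \<eta>f by auto
    then show ?thesis by (intro that[of "Suc m"]) (auto simp: inverse_eq_divide)
  qed
  \<comment> \<open>The defect of cell \<open>i\<close>: the increment of \<open>S\<close> minus
    that of the linear function of slope \<open>f (i / n)\<close>, magnified to unit length.\<close>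
  define x where "x i = real n *\<^sub>R (S ((real i + 1) / real n) - S (real i / real n)) - f (real i / real n)" for i
  have pnx: "pn (x i) \<le> \<delta>" if "i < n" for i
  proof -
    have len: "(real i + 1) / real n - real i / real n = 1 / real n"
      by (simp flip: diff_divide_distrib)
    have "(real i + 1) / real n \<le> 1" "real i / real n \<le> (real i + 1) / real n"
      using that by (auto simp: divide_right_mono)
    then have "pn (S ((real i + 1) / real n) - S (real i / real n) - (1 / real n) *\<^sub>R f (real i / real n))
        \<le> \<delta> * (1 / real n) powr p"
      using \<eta>S(2)[of "real i / real n" "(real i + 1) / real n"] n(2) by (simp add: len)
    then have "pn (real n *\<^sub>R (S ((real i + 1) / real n) - S (real i / real n) - (1 / real n) *\<^sub>R f (real i / real n)))
        \<le> \<delta> * (real n * (1 / real n)) powr p"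
      using pn_le_rescale[of "real n" "1 / real n"] n by simp
    then show ?thesis using n by (simp add: x_def scaleR_diff_right)
  qed
  have "\<exists>G \<eta>. 0 < \<eta> \<and> G 0 = 0 \<and> G 1 = x i \<and>
    (\<forall>u v. 0 \<le> u \<longrightarrow> u \<le> v \<longrightarrow> v \<le> 1 \<longrightarrow> pn (G v - G u) \<le> lip_const * pn (x i) * (v - u) powr p) \<and>
    (\<forall>u v. 0 \<le> u \<longrightarrow> u \<le> v \<longrightarrow> v \<le> 1 \<longrightarrow> v - u \<le> \<eta> \<longrightarrow> pn (G v - G u) \<le> \<epsilon> * (v - u) powr p)" for i
    by (rule path_with_small_velocity[OF \<epsilon>(1), of "x i"]) blast
  then obtain G \<eta> where \<eta>0: "\<And>i. 0 < \<eta> i" and G0: "\<And>i. G i 0 = 0" and G1: "\<And>i. G i 1 = x i"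
    and Glip: "\<And>i u v. 0 \<le> u \<Longrightarrow> u \<le> v \<Longrightarrow> v \<le> 1 \<Longrightarrow>
      pn (G i v - G i u) \<le> lip_const * pn (x i) * (v - u) powr p"
    and Gloc: "\<And>i u v. 0 \<le> u \<Longrightarrow> u \<le> v \<Longrightarrow> v \<le> 1 \<Longrightarrow> v - u \<le> \<eta> i \<Longrightarrow>
      pn (G i v - G i u) \<le> \<epsilon> * (v - u) powr p"
    by metis
  define g where "g i u = u *\<^sub>R f (real i / real n) + G i u" for i and u :: real
  define S' where "S' = concat_path n g"
  have g0: "g i 0 = 0" for i by (simp add: g_def G0)
  \<comment> \<open>The end points telescope, using \<open>S 0 = 0\<close>; hence \<open>S'\<close>
    and \<open>S\<close> agree at the nodes.\<close>
  have node_sum: "(\<Sum>j<i. g j 1) = real n *\<^sub>R S (real i / real n)" for i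
    by (induction i) (simp_all add: S(2) g_def G1 x_def scaleR_diff_right add.commute)
  have cell: "S' ((real i + u) / real n) = S (real i / real n) + (1 / real n) *\<^sub>R g i u"
    if "i < n" "0 \<le> u" "u \<le> 1" for i u
    unfolding S'_def using concat_path_cell[of i n u g] that g0
    by (simp add: node_sum scaleR_add_right inverse_eq_divide)
  have node: "S' (real i / real n) = S (real i / real n)"
    and node': "S' ((real i + 1) / real n) = S ((real i + 1) / real n)" if "i < n" for i
    using cell[OF that, of 0] cell[OF that, of 1] n
    by (simp_all add: g_def G0 G1 x_def scaleR_diff_right)
  have cell_facts: "pn ((S' t - S t) - (S' s - S s)) \<le> (lip_const + 2) * \<delta> * (t - s) powr p \<and>
      (v - u \<le> \<eta> i \<longrightarrow> pn (S' t - S' s - (t - s) *\<^sub>R f s) \<le> (\<delta>' / 4) * (t - s) powr p)"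
    if i: "i < n" and uv: "0 \<le> u" "u \<le> v" "v \<le> 1"
      and s: "s = (real i + u) / real n" and t: "t = (real i + v) / real n" for i u v s t
  proof -
    define a where "a = real i / real n"
    have ts: "t - s = (v - u) / real n" by (simp add: s t flip: diff_divide_distrib)
    have as: "s - a = u / real n" by (simp add: s a_def flip: diff_divide_distrib)
    have ord: "0 \<le> a" "a \<le> s" "s \<le> t" "t \<le> 1"
      using i uv n by (auto simp: a_def s t divide_le_eq intro!: divide_right_mono)
    have "t - s \<le> 1 / real n" "s - a \<le> 1 / real n"
      using uv by (auto simp: ts as intro!: divide_right_mono)
    with n have small: "t - s \<le> \<eta>S" "s - a \<le> \<eta>f" by auto
    define dG where "dG = (1 / real n) *\<^sub>R (G i v - G i u)"
    have dG: "pn dG \<le> c * (t - s) powr p" if "pn (G i v - G i u) \<le> c * (v - u) powr p" for c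
      using pn_le_rescale[of "1 / real n" "v - u" "G i v - G i u" c] that n uv by (simp add: dG_def ts)
    have lip: "pn dG \<le> lip_const * \<delta> * (t - s) powr p"
    proof (rule dG)
      have "lip_const * pn (x i) * (v - u) powr p \<le> lip_const * \<delta> * (v - u) powr p"
        using pnx[OF i] lip_const_ge_1 by (intro mult_right_mono mult_left_mono) auto
      with Glip[OF uv, of i] show "pn (G i v - G i u) \<le> lip_const * \<delta> * (v - u) powr p" by linarith
    qed
    have S'diff: "S' t - S' s = dG + (t - s) *\<^sub>R f a"
      using cell[OF i, of u] cell[OF i, of v] uv
      by (simp add: s[symmetric] t[symmetric] dG_def ts g_def a_def scaleR_add_right
          scaleR_diff_right diff_divide_distrib scaleR_left_diff_distrib)
    have osc: "pn ((t - s) *\<^sub>R (f a - f s)) \<le> \<epsilon> * (t - s) powr p"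
      using \<eta>f(2)[of a s] ord small by (intro pn_scaled_le) auto
    have Sd: "pn (- (S t - S s - (t - s) *\<^sub>R f s)) \<le> \<delta> * (t - s) powr p"
      unfolding pn_uminus using \<eta>S(2) ord small by simp
    \<comment> \<open>The three terms are the slow path, the error of \<open>S\<close> and the
      oscillation of \<open>f\<close>; they cost \<open>lip_const * \<delta>\<close>,
      \<open>\<delta>\<close> and \<open>\<epsilon>\<close>.\<close>
    have eq: "(S' t - S t) - (S' s - S s) =
        dG + - (S t - S s - (t - s) *\<^sub>R f s) + (t - s) *\<^sub>R (f a - f s)"
      using S'diff by (simp add: algebra_simps)
    have "pn ((S' t - S t) - (S' s - S s)) \<le>
        lip_const * \<delta> * (t - s) powr p + \<delta> * (t - s) powr p + \<epsilon> * (t - s) powr p"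
      unfolding eq
      using pn_add3[of dG "- (S t - S s - (t - s) *\<^sub>R f s)" "(t - s) *\<^sub>R (f a - f s)"] lip Sd osc
      by linarith
    also have "\<dots> \<le> (lip_const + 2) * \<delta> * (t - s) powr p"
      using mult_right_mono[OF \<epsilon>(2), of "(t - s) powr p"] by (simp add: algebra_simps)
    finally have 1: "pn ((S' t - S t) - (S' s - S s)) \<le> (lip_const + 2) * \<delta> * (t - s) powr p" .
    have "pn (S' t - S' s - (t - s) *\<^sub>R f s) \<le> (\<delta>' / 4) * (t - s) powr p" if "v - u \<le> \<eta> i"
    proof -
      have "S' t - S' s - (t - s) *\<^sub>R f s = dG + (t - s) *\<^sub>R (f a - f s)"
        using S'diff by (simp add: algebra_simps)
      then have "pn (S' t - S' s - (t - s) *\<^sub>R f s) \<le> \<epsilon> * (t - s) powr p + \<epsilon> * (t - s) powr p"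
        using pn_add[of dG "(t - s) *\<^sub>R (f a - f s)"] dG[OF Gloc[OF uv that]] osc by simp
      also have "\<dots> \<le> (\<delta>' / 4) * (t - s) powr p"
        using mult_right_mono[OF \<epsilon>(3), of "(t - s) powr p"] by simp
      finally show ?thesis .
    qed
    with 1 show ?thesis by blast
  qed
  have lip: "pn ((S' t - S t) - (S' s - S s)) \<le> step_const * \<delta> * (t - s) powr p"
    if st: "0 \<le> s" "s \<le> t" "t \<le> 1" for s t
  proof (cases "s = t")
    case False
    with st have "s < t" by simp
    obtain i u j v where ij: "i \<le> j" "j < n" and u: "0 \<le> u" "u \<le> 1" "s = (real i + u) / real n"
      and v: "0 \<le> v" "v \<le> 1" "t = (real j + v) / real n"
      using unit_interval_cells[OF n(1) st(1) \<open>s < t\<close> st(3)] .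
    define c where "c = (lip_const + 2) * \<delta>"
    have c: "c \<ge> 0" using lip_const_ge_1 pos by (simp add: c_def)
    have "pn ((S' t - S t) - (S' s - S s)) \<le> c * (t - s) powr p + c * (t - s) powr p"
    proof (cases "i = j")
      case True
      have "u \<le> v" using \<open>s < t\<close> n True by (simp add: u(3) v(3) divide_less_cancel)
      then have "pn ((S' t - S t) - (S' s - S s)) \<le> c * (t - s) powr p"
        using cell_facts[of i u v s t] True ij u v by (simp add: c_def)
      moreover have "0 \<le> c * (t - s) powr p" using c by simp
      ultimately show ?thesis by linarith
    next
      case False
      then have "real i + 1 \<le> real j" using ij by linarith
      \<comment> \<open>The first node after \<open>s\<close> and the last before \<open>t\<close>.
        Since \<open>S'\<close> and \<open>S\<close> agree there, the complete cells in between cost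
        nothing.\<close>
      define b where "b = (real i + 1) / real n"
      define b' where "b' = real j / real n"
      have ord: "s \<le> b" "b \<le> b'" "b' \<le> t"
        using u v \<open>real i + 1 \<le> real j\<close> by (auto simp: b_def b'_def intro!: divide_right_mono)
      have b0: "S' b = S b" "S' b' = S b'"
        using node'[of i] node[of j] ij by (auto simp: b_def b'_def)
      have "pn ((S' b - S b) - (S' s - S s)) \<le> c * (b - s) powr p"
        using cell_facts[of i u 1 s b] ij u by (simp add: c_def b_def)
      also have "\<dots> \<le> c * (t - s) powr p" using ord c by (intro mult_left_mono powr_mono_p) auto
      finally have 1: "pn (- (S' s - S s)) \<le> c * (t - s) powr p" using b0 by simp
      have "pn ((S' t - S t) - (S' b' - S b')) \<le> c * (t - b') powr p"
        using cell_facts[of j 0 v b' t] ij v by (simp add: c_def b'_def)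
      also have "\<dots> \<le> c * (t - s) powr p" using ord c by (intro mult_left_mono powr_mono_p) auto
      finally have 2: "pn (S' t - S t) \<le> c * (t - s) powr p" using b0 by simp
      show ?thesis
        using pn_diff[of "S' t - S t" "S' s - S s"] 1[unfolded pn_uminus] 2 by linarith
    qed
    then show ?thesis by (simp add: step_const_def c_def algebra_simps)
  qed simp
  \<comment> \<open>After magnification by \<open>n\<close> such an interval is below every scale
    \<open>\<eta> k\<close> and below \<open>1/2\<close>, so it meets at most two adjacent
    cells.\<close>
  define \<eta>' where "\<eta>' = min (Min (\<eta> ` {..<n})) (1/2) / real n"
  have Min: "0 < Min (\<eta> ` {..<n})" "\<And>i. i < n \<Longrightarrow> Min (\<eta> ` {..<n}) \<le> \<eta> i"
  proof -
    have "Min (\<eta> ` {..<n}) \<in> \<eta> ` {..<n}" using n by (intro Min_in) auto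
    then show "0 < Min (\<eta> ` {..<n})" using \<eta>0 by auto
  qed (auto intro: Min_le)
  have \<eta>': "\<eta>' > 0" using Min n by (simp add: \<eta>'_def)
  have "pn (S' t - S' s - (t - s) *\<^sub>R f s) \<le> \<delta>' * (t - s) powr p"
    if st: "0 \<le> s" "s \<le> t" "t \<le> 1" "t - s \<le> \<eta>'" for s t
  proof (cases "s = t")
    case False
    with st have "s < t" by simp
    obtain i u j v where ij: "i \<le> j" "j < n" and u: "0 \<le> u" "u \<le> 1" "s = (real i + u) / real n"
      and v: "0 \<le> v" "v \<le> 1" "t = (real j + v) / real n"
      using unit_interval_cells[OF n(1) st(1) \<open>s < t\<close> st(3)] .
    have nts: "real n * (t - s) = (real j + v) - (real i + u)"
      using n by (simp add: u(3) v(3) right_diff_distrib)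
    have le: "real n * (t - s) \<le> 1/2" "\<And>k. k < n \<Longrightarrow> real n * (t - s) \<le> \<eta> k"
    proof -
      have "real n * (t - s) \<le> real n * \<eta>'" using st(4) by (intro mult_left_mono) auto
      also have "\<dots> = min (Min (\<eta> ` {..<n})) (1/2)" using n(1) by (simp add: \<eta>'_def)
      finally have "real n * (t - s) \<le> min (Min (\<eta> ` {..<n})) (1/2)" .
      then show "real n * (t - s) \<le> 1/2" "\<And>k. k < n \<Longrightarrow> real n * (t - s) \<le> \<eta> k"
        using Min(2) by (auto intro: order_trans)
    qed
    show ?thesis
    proof (cases "i = j")
      case True
      have "u \<le> v" using \<open>s < t\<close> n True by (simp add: u(3) v(3) divide_less_cancel)
      moreover have "v - u \<le> \<eta> i" using nts True le(2)[of i] ij by simp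
      ultimately have "pn (S' t - S' s - (t - s) *\<^sub>R f s) \<le> (\<delta>' / 4) * (t - s) powr p"
        using cell_facts[of i u v s t] True ij u v by simp
      also have "\<dots> \<le> \<delta>' * (t - s) powr p" using pos by (intro mult_right_mono) auto
      finally show ?thesis .
    next
      case False
      have "real j \<le> real i + 1/2 + u" using nts le(1) v by linarith
      then have "real j < real i + 2" using u by linarith
      with ij False have j: "j = Suc i" by linarith
      define b where "b = (real i + 1) / real n"
      have len: "real n * (t - s) = (1 - u) + v" using nts j by simp
      have ord: "s \<le> b" "b \<le> t"
        using u v by (auto simp: b_def j intro!: divide_right_mono)
      have "1 - u \<le> \<eta> i" using le(2)[of i] ij len v by simp
      then have "pn (S' b - S' s - (b - s) *\<^sub>R f s) \<le> (\<delta>' / 4) * (b - s) powr p"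
        using cell_facts[of i u 1 s b] ij u by (simp add: b_def)
      also have "\<dots> \<le> (\<delta>' / 4) * (t - s) powr p"
        using ord pos by (intro mult_left_mono powr_mono_p) auto
      finally have 1: "pn (S' b - S' s - (b - s) *\<^sub>R f s) \<le> (\<delta>' / 4) * (t - s) powr p" .
      have "v \<le> \<eta> j" using le(2)[of j] ij len u by simp
      then have "pn (S' t - S' b - (t - b) *\<^sub>R f b) \<le> (\<delta>' / 4) * (t - b) powr p"
        using cell_facts[of j 0 v b t] ij v j by (simp add: b_def add.commute)
      also have "\<dots> \<le> (\<delta>' / 4) * (t - s) powr p"
        using ord pos by (intro mult_left_mono powr_mono_p) auto
      finally have 2: "pn (S' t - S' b - (t - b) *\<^sub>R f b) \<le> (\<delta>' / 4) * (t - s) powr p" .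
      have "b - s \<le> 1 / real n" by (simp add: b_def u(3) divide_right_mono u flip: diff_divide_distrib)
      then have "pn (f s - f b) \<le> \<epsilon>" using \<eta>f(2)[of s b] ord st n by simp
      then have "pn ((t - b) *\<^sub>R (f b - f s)) \<le> \<epsilon> * (t - b) powr p"
        using ord by (intro pn_scaled_le) (auto simp: pn_minus_commute)
      also have "\<dots> \<le> (\<delta>' / 4) * (t - s) powr p"
        using ord pos \<epsilon> by (intro mult_mono powr_mono_p) auto
      finally have 3: "pn ((t - b) *\<^sub>R (f b - f s)) \<le> (\<delta>' / 4) * (t - s) powr p" .
      \<comment> \<open>Splitting at the node \<open>b\<close> leaves one error on each side and the
        change of slope from \<open>f s\<close> to \<open>f b\<close>, each at most
        \<open>\<delta>' / 4\<close>.\<close>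
      have eq: "S' t - S' s - (t - s) *\<^sub>R f s = (S' b - S' s - (b - s) *\<^sub>R f s)
          + (S' t - S' b - (t - b) *\<^sub>R f b) + (t - b) *\<^sub>R (f b - f s)"
        by (simp add: algebra_simps)
      have "pn (S' t - S' s - (t - s) *\<^sub>R f s) \<le> 3 * ((\<delta>' / 4) * (t - s) powr p)"
        unfolding eq using pn_add3[of "S' b - S' s - (b - s) *\<^sub>R f s" "S' t - S' b - (t - b) *\<^sub>R f b"
            "(t - b) *\<^sub>R (f b - f s)"] 1 2 3 by linarith
      also have "\<dots> \<le> \<delta>' * (t - s) powr p" using pos by simp
      finally show ?thesis .
    qed
  qed simp
  then have "almost_primitive f \<delta>' S'" unfolding almost_primitive_def using \<eta>' by blast
  moreover have "S' 0 = 0" using node[of 0] n S(2) by simp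
  ultimately show ?thesis using lip by blast
qed

text \<open>Starting from the zero function, each improvement halves the error. The limit
  \<open>F\<close> differs from \<open>S k\<close> by a function with bound
  \<open>K * \<delta> k\<close>, and \<open>S k\<close> has error \<open>\<delta> k\<close>, so
  \<open>F\<close> has error at most \<open>(K + 1) * \<delta> k\<close> for every
  \<open>k\<close>.\<close>

lemma exists_almost_primitive:
  assumes f: "continuous_on {0..1} f"
  obtains F where "F 0 = 0" "\<And>e. e > 0 \<Longrightarrow> almost_primitive f e F"
proof -
  have "compact (f ` {0..1})" using f by (intro compact_continuous_image) auto
  then obtain B where "\<forall>t\<in>{0..1}. pn (f t) \<le> B"
    using compact_imp_bounded[of "f ` {0..1}"] unfolding bounded_any_center[where a = 0]
    by (auto simp: dist_pn)
  then have B: "pn (f t) \<le> B" if "t \<in> {0..1}" for t using that by blast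
  define \<delta> where "\<delta> k = (\<bar>B\<bar> + 1) / 2 ^ k" for k :: nat
  have \<delta>: "\<delta> k > 0" "\<delta> (Suc k) = \<delta> k / 2" for k by (auto simp: \<delta>_def)
  have "\<exists>S. \<forall>k. (S k 0 = 0 \<and> almost_primitive f (\<delta> k) (S k)) \<and>
    (\<forall>s t. 0 \<le> s \<longrightarrow> s \<le> t \<longrightarrow> t \<le> 1 \<longrightarrow>
      pn ((S (Suc k) t - S k t) - (S (Suc k) s - S k s)) \<le> step_const * \<delta> k * (t - s) powr p)"
  proof (rule dependent_nat_choice)
    have "pn (- ((t - s) *\<^sub>R f s)) \<le> \<delta> 0 * (t - s) powr p" if "0 \<le> s" "s \<le> t" "t \<le> 1" for s t
      unfolding pn_uminus using that B[of s] by (intro pn_scaled_le) (auto simp: \<delta>_def)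
    then have "almost_primitive f (\<delta> 0) (\<lambda>t. 0)"
      unfolding almost_primitive_def by (intro exI[of _ 1]) simp
    then show "\<exists>S. S 0 = 0 \<and> almost_primitive f (\<delta> 0) S" by (intro exI[of _ "\<lambda>t. 0"]) simp
  next
    fix S k assume S: "S 0 = 0 \<and> almost_primitive f (\<delta> k) S"
    then show "\<exists>T. (T 0 = 0 \<and> almost_primitive f (\<delta> (Suc k)) T) \<and>
      (\<forall>s t. 0 \<le> s \<longrightarrow> s \<le> t \<longrightarrow> t \<le> 1 \<longrightarrow>
        pn ((T t - S t) - (T s - S s)) \<le> step_const * \<delta> k * (t - s) powr p)"
      by (intro improve_almost_primitive f \<delta>(1)) simp_all
  qed
  then obtain S where S0: "\<And>k. S k 0 = 0" and Sa: "\<And>k. almost_primitive f (\<delta> k) (S k)"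
    and Sd: "\<And>k s t. 0 \<le> s \<Longrightarrow> s \<le> t \<Longrightarrow> t \<le> 1 \<Longrightarrow>
      pn ((S (Suc k) t - S k t) - (S (Suc k) s - S k s)) \<le> step_const * \<delta> k * (t - s) powr p"
    by blast
  \<comment> \<open>As \<open>\<delta> k = 2 * (\<delta> k - \<delta> (Suc k))\<close>, this factor
    makes the sum of the corrections telescope.\<close>
  define K where "K = 2 * step_const"
  have K: "K > 0" using lip_const_ge_1 by (simp add: K_def step_const_def)
  have tail: "pn ((S (k + m) t - S k t) - (S (k + m) s - S k s)) \<le> K * (\<delta> k - \<delta> (k + m)) * (t - s) powr p"
    if st: "0 \<le> s" "s \<le> t" "t \<le> 1" for s t k m
  proof (induction m)
    case (Suc m)
    have "(S (k + Suc m) t - S k t) - (S (k + Suc m) s - S k s) =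
      ((S (k + m) t - S k t) - (S (k + m) s - S k s)) +
      ((S (Suc (k + m)) t - S (k + m) t) - (S (Suc (k + m)) s - S (k + m) s))" by simp
    then have "pn ((S (k + Suc m) t - S k t) - (S (k + Suc m) s - S k s)) \<le>
        K * (\<delta> k - \<delta> (k + m)) * (t - s) powr p + step_const * \<delta> (k + m) * (t - s) powr p"
      using pn_add Suc Sd[OF st, of "k + m"] by (smt (verit))
    also have "\<dots> = K * (\<delta> k - \<delta> (k + Suc m)) * (t - s) powr p"
      by (simp add: K_def \<delta>(2) algebra_simps)
    finally show ?case .
  qed simp
  have tail': "pn ((S m t - S k t) - (S m s - S k s)) \<le> K * \<delta> k * (t - s) powr p"
    if st: "0 \<le> s" "s \<le> t" "t \<le> 1" and "k \<le> m" for s t k m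
  proof -
    have "K * (\<delta> k - \<delta> m) * (t - s) powr p \<le> K * \<delta> k * (t - s) powr p"
      using K \<delta>(1)[of m] by (intro mult_right_mono mult_left_mono) auto
    with tail[OF st, of k "m - k"] \<open>k \<le> m\<close> show ?thesis by simp
  qed
  have \<delta>_lim: "(\<lambda>k. c * \<delta> k) \<longlonglongrightarrow> 0" for c
  proof -
    have "(\<lambda>k. (c * (\<bar>B\<bar> + 1)) * (1/2) ^ k) \<longlonglongrightarrow> (c * (\<bar>B\<bar> + 1)) * 0"
      by (intro tendsto_mult tendsto_const LIMSEQ_realpow_zero) auto
    then show ?thesis by (simp add: \<delta>_def power_divide mult_ac)
  qed
  define F where "F t = lim (\<lambda>k. S k t)" for t
  have lim: "(\<lambda>k. S k t) \<longlonglongrightarrow> F t" if t: "0 \<le> t" "t \<le> 1" for t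
  proof -
    have "Cauchy (\<lambda>k. S k t)"
    proof (rule metric_CauchyI)
      fix e :: real assume "e > 0"
      then have "\<forall>\<^sub>F k in sequentially. (2 * K) * \<delta> k < e"
        using \<delta>_lim by (intro order_tendstoD(2)) auto
      then obtain k where k: "(2 * K) * \<delta> k < e" by (auto simp: eventually_sequentially)
      have le: "dist (S m t) (S k t) \<le> K * \<delta> k" if "m \<ge> k" for m
      proof -
        have "pn (S m t - S k t) \<le> K * \<delta> k * t powr p"
          using tail'[of 0 t k m] t S0 that by simp
        also have "\<dots> \<le> K * \<delta> k * 1"
          using K \<delta>(1)[of k] powr_le_one[OF t] by (intro mult_left_mono) auto
        finally show ?thesis by (simp add: dist_pn)
      qed
      show "\<exists>M. \<forall>m\<ge>M. \<forall>n\<ge>M. dist (S m t) (S n t) < e"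
      proof (intro exI allI impI)
        fix m n assume "k \<le> m" "k \<le> n"
        then show "dist (S m t) (S n t) < e"
          using dist_triangle2[of "S m t" "S n t" "S k t"] le[of m] le[of n] k by linarith
      qed
    qed
    then show ?thesis unfolding F_def by (simp add: Cauchy_convergent_iff convergent_LIMSEQ_iff)
  qed
  have swap: "(a - b) - (c - d) = (a - c) - (b - d)" for a b c d :: 'a by simp
  \<comment> \<open>Let \<open>m\<close> tend to infinity in \<open>tail'\<close>; the metric is
    continuous, so the bound passes to the limit.\<close>
  have limit_tail: "pn ((F t - S k t) - (F s - S k s)) \<le> K * \<delta> k * (t - s) powr p"
    if st: "0 \<le> s" "s \<le> t" "t \<le> 1" for s t k
  proof -
    have "(\<lambda>m. S m t - S m s) \<longlonglongrightarrow> F t - F s"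
      using st by (intro tendsto_diff_pn lim) auto
    then have "(\<lambda>m. dist (S m t - S m s) (S k t - S k s)) \<longlonglongrightarrow> dist (F t - F s) (S k t - S k s)"
      by (intro tendsto_dist tendsto_const)
    moreover have "dist (S m t - S m s) (S k t - S k s) \<le> K * \<delta> k * (t - s) powr p" if "k \<le> m" for m
      unfolding dist_pn swap[of "S m t"] by (rule tail'[OF st that])
    ultimately have "dist (F t - F s) (S k t - S k s) \<le> K * \<delta> k * (t - s) powr p"
      by (intro LIMSEQ_le_const2) auto
    then show ?thesis unfolding dist_pn swap[of "F t"] .
  qed
  have "almost_primitive f e F" if "e > 0" for e
  proof -
    have "\<forall>\<^sub>F k in sequentially. (K + 1) * \<delta> k < e"
      using \<delta>_lim that by (intro order_tendstoD(2)) auto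
    then obtain k where k: "(K + 1) * \<delta> k < e" by (auto simp: eventually_sequentially)
    obtain \<eta> where \<eta>: "\<eta> > 0" "\<And>s t. 0 \<le> s \<Longrightarrow> s \<le> t \<Longrightarrow> t \<le> 1 \<Longrightarrow> t - s \<le> \<eta> \<Longrightarrow>
        pn (S k t - S k s - (t - s) *\<^sub>R f s) \<le> \<delta> k * (t - s) powr p"
      using Sa[of k] unfolding almost_primitive_def by blast
    have "pn (F t - F s - (t - s) *\<^sub>R f s) \<le> e * (t - s) powr p"
      if st: "0 \<le> s" "s \<le> t" "t \<le> 1" "t - s \<le> \<eta>" for s t
    proof -
      have "F t - F s - (t - s) *\<^sub>R f s =
          ((F t - S k t) - (F s - S k s)) + (S k t - S k s - (t - s) *\<^sub>R f s)" by simp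
      then have "pn (F t - F s - (t - s) *\<^sub>R f s) \<le> K * \<delta> k * (t - s) powr p + \<delta> k * (t - s) powr p"
        using pn_add limit_tail[OF st(1-3), of k] \<eta>(2)[OF st] by (smt (verit))
      also have "\<dots> = ((K + 1) * \<delta> k) * (t - s) powr p" by (simp add: algebra_simps)
      also have "\<dots> \<le> e * (t - s) powr p" using k by (intro mult_right_mono) auto
      finally show ?thesis .
    qed
    with \<eta>(1) show ?thesis unfolding almost_primitive_def by blast
  qed
  moreover have "F 0 = 0" using lim[of 0] LIMSEQ_unique[of "\<lambda>k. 0::'a"] by (simp add: S0)
  ultimately show ?thesis using that by blast
qed

end

section \<open>Existence of primitives\<close>

lemma diff_quot_commute: "diff_quot f s t = diff_quot f t s"
proof -
  have "diff_quot f s t = (- (f t - f s)) /\<^sub>R (- (t - s))" by (simp add: diff_quot_def)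
  also have "\<dots> = diff_quot f t s"
    by (simp only: diff_quot_def inverse_minus_eq scaleR_minus_left scaleR_minus_right minus_minus)
  finally show ?thesis .
qed

context p_exponent
begin

text \<open>\<open>almost_primitive\<close> compares with \<open>f\<close> at the left end. When
  \<open>t\<close> is the right end, the oscillation of \<open>f\<close> transfers the value from
  \<open>s\<close> to \<open>t\<close> at the price of another \<open>e / 2\<close>.\<close>

lemma diff_quot_approx:
  assumes f: "continuous_on {0..1} f" and F: "\<And>e. e > 0 \<Longrightarrow> almost_primitive f e F" and e: "e > 0"
  obtains \<eta> where "\<eta> > 0" "\<And>s t. s \<in> {0..1} \<Longrightarrow> t \<in> {0..1} \<Longrightarrow> s \<noteq> t \<Longrightarrow> \<bar>s - t\<bar> \<le> \<eta> \<Longrightarrow>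
    pn (diff_quot F s t - f t) \<le> e"
proof -
  obtain \<eta> where \<eta>: "\<eta> > 0" "\<And>s t. 0 \<le> s \<Longrightarrow> s \<le> t \<Longrightarrow> t \<le> 1 \<Longrightarrow> t - s \<le> \<eta> \<Longrightarrow>
      pn (F t - F s - (t - s) *\<^sub>R f s) \<le> e / 2 * (t - s) powr p"
    using F[of "e / 2"] e unfolding almost_primitive_def by auto
  obtain \<eta>f where \<eta>f: "\<eta>f > 0"
    "\<And>s t. 0 \<le> s \<Longrightarrow> s \<le> t \<Longrightarrow> t \<le> 1 \<Longrightarrow> t - s \<le> \<eta>f \<Longrightarrow> pn (f s - f t) \<le> e / 2"
    using uniform_oscillation[OF f, of "e / 2"] e by auto
  have right: "pn (diff_quot F s t - f t) \<le> e / 2"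
    if "0 \<le> t" "t < s" "s \<le> 1" "s - t \<le> \<eta>" for s t
  proof -
    have "(s - t) *\<^sub>R (diff_quot F s t - f t) = F s - F t - (s - t) *\<^sub>R f t"
      using that by (simp add: diff_quot_def scaleR_diff_right)
    then show ?thesis
      using \<eta>(2)[of t s] that pn_le_rescale[of "s - t" 1 "diff_quot F s t - f t" "e / 2"] by simp
  qed
  show ?thesis
  proof (rule that[of "min \<eta> \<eta>f"])
    fix s t :: real assume st: "s \<in> {0..1}" "t \<in> {0..1}" "s \<noteq> t" "\<bar>s - t\<bar> \<le> min \<eta> \<eta>f"
    show "pn (diff_quot F s t - f t) \<le> e"
    proof (cases "t < s")
      case True
      then show ?thesis using right[of t s] st e by simp
    next
      case False
      have "pn (diff_quot F t s - f s) \<le> e / 2" "pn (f s - f t) \<le> e / 2"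
        using right[of s t] \<eta>f(2)[of s t] False st by auto
      then show ?thesis
        using pn_add[of "diff_quot F t s - f s" "f s - f t"] diff_quot_commute[of F s t] by simp
    qed
  qed (use \<eta> \<eta>f in simp)
qed

text \<open>The uniformity of \<open>diff_quot_approx\<close> gives both the derivative and joint
  continuity on the diagonal. Off the diagonal the quotient is continuous because \<open>F\<close>
  is, and \<open>F\<close> is continuous because \<open>F s - F t\<close> is \<open>s - t\<close>
  times a convergent quotient.\<close>

lemma primitive_in_C1I:
  assumes f: "continuous_on {0..1} f" and F: "\<And>e. e > 0 \<Longrightarrow> almost_primitive f e F"
    and ext: "F \<in> extensional {0..1}"
  shows "F \<in> C1I" and "\<And>t. t \<in> {0..1} \<Longrightarrow> has_derivI F (f t) t"
    and "\<And>t. t \<in> {0..1} \<Longrightarrow> derivI F t = f t"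
proof -
  show deriv: "has_derivI F (f t) t" if t: "t \<in> {0..1}" for t
    unfolding has_derivI_def tendsto_iff eventually_at
  proof (intro allI impI)
    fix e :: real assume "e > 0"
    then obtain \<eta> where \<eta>: "\<eta> > 0" "\<And>s t. s \<in> {0..1} \<Longrightarrow> t \<in> {0..1} \<Longrightarrow> s \<noteq> t \<Longrightarrow> \<bar>s - t\<bar> \<le> \<eta> \<Longrightarrow>
        pn (diff_quot F s t - f t) \<le> e / 2"
      using diff_quot_approx[OF f F, of "e / 2"] by auto
    show "\<exists>d>0. \<forall>s\<in>{0..1}. s \<noteq> t \<and> dist s t < d \<longrightarrow> dist (diff_quot F s t) (f t) < e"
    proof (intro exI[of _ \<eta>] conjI ballI impI \<eta>(1))
      fix s :: real assume "s \<in> {0..1}" "s \<noteq> t \<and> dist s t < \<eta>"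
      then have "pn (diff_quot F s t - f t) \<le> e / 2"
        using t by (intro \<eta>(2)) (auto simp: dist_real_def)
      with \<open>e > 0\<close> show "dist (diff_quot F s t) (f t) < e" by (simp add: dist_pn)
    qed
  qed
  show derivI: "derivI F t = f t" if t: "t \<in> {0..1}" for t
  proof -
    have "at t within {0..1} \<noteq> bot"
      using t by (simp add: trivial_limit_within islimpt_Icc)
    then show ?thesis
      unfolding derivI_def using deriv[OF t] by (intro tendsto_Lim) (auto simp: has_derivI_def)
  qed
  have cont: "continuous_on {0..1} F"
    unfolding continuous_on_def
  proof
    fix t :: real assume t: "t \<in> {0..1}"
    have "((\<lambda>s. s - t) \<longlongrightarrow> 0) (at t within {0..1})"
      by (rule LIM_zero) (rule tendsto_ident_at)
    then have "((\<lambda>s. (s - t) *\<^sub>R diff_quot F s t) \<longlongrightarrow> 0 *\<^sub>R f t) (at t within {0..1})"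
      using deriv[OF t] by (intro tendsto_scaleR_pn) (auto simp: has_derivI_def)
    moreover have "(s - t) *\<^sub>R diff_quot F s t = F s - F t" if "s \<noteq> t" for s
      using that by (simp add: diff_quot_def)
    then have "\<forall>\<^sub>F s in at t within {0..1}. (s - t) *\<^sub>R diff_quot F s t = F s - F t"
      by (simp add: eventually_at_filter)
    ultimately have "((\<lambda>s. F s - F t) \<longlongrightarrow> 0) (at t within {0..1})"
      by (simp add: tendsto_cong)
    then show "(F \<longlongrightarrow> F t) (at t within {0..1})"
      by (simp add: tendsto_pn_iff[of F] tendsto_pn_iff[of "\<lambda>s. F s - F t"])
  qed
  let ?Q = "{0..1::real} \<times> {0..1::real}"
  let ?h = "\<lambda>(s, t). if s = t then derivI F t else diff_quot F s t"
  have "continuous_on ?Q ?h"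
    unfolding continuous_on_def
  proof
    fix z assume z: "z \<in> ?Q"
    obtain s t where st: "z = (s, t)" "s \<in> {0..1}" "t \<in> {0..1}" using z by auto
    show "(?h \<longlongrightarrow> ?h z) (at z within ?Q)"
    proof (cases "s = t")
      case False
      have cF: "continuous_on ?Q (\<lambda>w. F (fst w))" "continuous_on ?Q (\<lambda>w. F (snd w))"
        by (rule continuous_on_compose2[OF cont]; auto intro: continuous_intros)+
      have lim: "((\<lambda>w. fst w - snd w) \<longlongrightarrow> s - t) (at z within ?Q)"
        using st(1) by (auto intro!: tendsto_eq_intros)
      have "((\<lambda>w. inverse (fst w - snd w) *\<^sub>R (F (fst w) - F (snd w)))
          \<longlongrightarrow> inverse (s - t) *\<^sub>R (F s - F t)) (at z within ?Q)"
        using cF z st(1) False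
        by (intro tendsto_scaleR_pn tendsto_diff_pn tendsto_inverse lim)
           (auto simp: continuous_on_def)
      moreover have "\<forall>\<^sub>F w in at z within ?Q. fst w - snd w \<noteq> 0"
        using lim False by (intro tendsto_imp_eventually_ne) auto
      then have "\<forall>\<^sub>F w in at z within ?Q. inverse (fst w - snd w) *\<^sub>R (F (fst w) - F (snd w)) = ?h w"
        by (rule eventually_mono) (auto simp: diff_quot_def split: prod.split)
      ultimately have "(?h \<longlongrightarrow> inverse (s - t) *\<^sub>R (F s - F t)) (at z within ?Q)"
        by (rule Lim_transform_eventually)
      with False st(1) show ?thesis by (simp add: diff_quot_def)
    next
      case True
      have "(?h \<longlongrightarrow> f t) (at z within ?Q)"
        unfolding tendsto_iff eventually_at
      proof (intro allI impI)
        fix e :: real assume e: "e > 0"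
        obtain \<eta> where \<eta>: "\<eta> > 0" "\<And>s t. s \<in> {0..1} \<Longrightarrow> t \<in> {0..1} \<Longrightarrow> s \<noteq> t \<Longrightarrow> \<bar>s - t\<bar> \<le> \<eta> \<Longrightarrow>
            pn (diff_quot F s t - f t) \<le> e / 3"
          using diff_quot_approx[OF f F, of "e / 3"] e by auto
        obtain \<eta>f where \<eta>f: "\<eta>f > 0"
          "\<And>s t. 0 \<le> s \<Longrightarrow> s \<le> t \<Longrightarrow> t \<le> 1 \<Longrightarrow> t - s \<le> \<eta>f \<Longrightarrow> pn (f s - f t) \<le> e / 3"
          using uniform_oscillation[OF f, of "e / 3"] e by auto
        have "dist (?h w) (f t) < e"
          if w: "w \<in> ?Q" and d: "dist w z < min \<eta> \<eta>f / 2" for w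
        proof -
          obtain u v where uv: "w = (u, v)" "u \<in> {0..1}" "v \<in> {0..1}" using w by auto
          have "\<bar>u - t\<bar> < min \<eta> \<eta>f / 2" "\<bar>v - t\<bar> < min \<eta> \<eta>f / 2"
            using d dist_fst_le[of w z] dist_snd_le[of w z] uv st(1) True
            by (auto simp: dist_real_def)
          then have close: "\<bar>u - v\<bar> \<le> \<eta>" "\<bar>v - t\<bar> \<le> \<eta>f" by linarith+
          have 1: "pn (f v - f t) \<le> e / 3"
            using \<eta>f(2)[of v t] \<eta>f(2)[of t v] close uv st
            by (cases "v \<le> t") (auto simp: pn_minus_commute[of "f v"])
          \<comment> \<open>This also covers \<open>u = v\<close>, where \<open>?h w\<close> is
            \<open>derivI F v = f v\<close>.\<close>
          have 2: "pn (?h w - f v) \<le> e / 3"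
            using \<eta>(2)[of u v] close uv derivI[OF uv(3)] e by auto
          show ?thesis
            using pn_add[of "?h w - f v" "f v - f t"] 1 2 e by (simp add: dist_pn)
        qed
        then show "\<exists>d>0. \<forall>w\<in>?Q. w \<noteq> z \<and> dist w z < d \<longrightarrow> dist (?h w) (f t) < e"
          using \<eta>(1) \<eta>f(1) by (intro exI[of _ "min \<eta> \<eta>f / 2"]) auto
      qed
      with True st show ?thesis by (simp add: derivI)
    qed
  qed
  with cont ext deriv show "F \<in> C1I" unfolding C1I_def CI_def by blast
qed

end

text \<open>On the diagonal the jointly continuous function from \<open>C1I\<close> is the
  derivative.\<close>

lemma D_in_CI:
  assumes "f \<in> C1I"
  shows "D f \<in> CI"
proof -
  have "continuous_on ({0..1} \<times> {0..1}) (\<lambda>(s, t). if s = t then derivI f t else diff_quot f s t)"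
    using assms by (simp add: C1I_def)
  then have "continuous_on {0..1} ((\<lambda>(s, t). if s = t then derivI f t else diff_quot f s t) \<circ> (\<lambda>t. (t, t)))"
    by (intro continuous_on_compose continuous_intros) (auto elim: continuous_on_subset)
  then have "continuous_on {0..1} (derivI f)" by (simp add: o_def)
  then have "continuous_on {0..1} (restrict (derivI f) {0..1})"
    by (rule continuous_on_eq) simp
  then show ?thesis by (simp add: CI_def D_def)
qed

context trivial_dual_space
begin

lemma exists_primitive:
  fixes f :: "real \<Rightarrow> 'a"
  assumes f: "continuous_on {0..1} f"
  obtains F where "F \<in> C1I0" "\<And>t. t \<in> {0..1} \<Longrightarrow> has_derivI F (f t) t" "D F = restrict f {0..1}"
proof -
  obtain G where G: "G 0 = 0" "\<And>e. e > 0 \<Longrightarrow> almost_primitive f e G"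
    using exists_almost_primitive[OF f] by blast
  \<comment> \<open>\<open>almost_primitive\<close> only looks at points of the unit interval, so
    restricting preserves it and makes the function extensional.\<close>
  define F where "F = restrict G {0..1}"
  have F: "almost_primitive f e F" if "e > 0" for e
    using G(2)[OF that] unfolding almost_primitive_def F_def by fastforce
  have ext: "F \<in> extensional {0..1}" by (simp add: F_def)
  note prim = primitive_in_C1I[OF f F ext]
  have "F \<in> C1I0" using prim(1) G(1) by (simp add: C1I0_def F_def)
  moreover have "D F = restrict f {0..1}"
    using prim(3) by (auto simp: D_def restrict_def)
  ultimately show ?thesis using that prim(2) by blast
qed

end

theorem theorem2:
  assumes trivial_dual:
    "\<And>\<phi> :: 'a::quasi_banach \<Rightarrow> real. linear \<phi> \<Longrightarrow> continuous_on UNIV \<phi> \<Longrightarrow> \<phi> = (\<lambda>x. 0)"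
  shows "D ` (C1I0 :: (real \<Rightarrow> 'a) set) = CI \<and>
    (\<forall>f :: real \<Rightarrow> 'a. continuous_on {0..1} f \<longrightarrow>
      (\<exists>F. \<forall>t\<in>{0..1}. has_derivI F (f t) t))"
proof -
  obtain p where p: "0 < p" "p < 1"
    "\<And>x y :: 'a. qnorm (x + y) powr p \<le> qnorm x powr p + qnorm y powr p"
    "\<And>x y :: 'a. dist x y = qnorm (x - y) powr p"
    using p_normed[where 'a = 'a] by auto
  interpret trivial_dual_space p "TYPE('a)"
    by unfold_locales (use p trivial_dual in auto)
  have "f \<in> D ` C1I0" if f: "f \<in> CI" for f :: "real \<Rightarrow> 'a"
  proof -
    \<comment> \<open>Members of \<open>CI\<close> are extensional, so
      \<open>D F = restrict f {0..1}\<close> is \<open>f\<close> itself.\<close>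
    from f have "continuous_on {0..1} f" "restrict f {0..1} = f"
      by (auto simp: CI_def extensional_restrict)
    then show ?thesis using exists_primitive[of f] by (metis imageI)
  qed
  moreover have "D f \<in> CI" if "f \<in> C1I0" for f :: "real \<Rightarrow> 'a"
    using that D_in_CI[of f] by (simp add: C1I0_def)
  moreover have "\<exists>F. \<forall>t\<in>{0..1}. has_derivI F (f t) t"
    if "continuous_on {0..1} f" for f :: "real \<Rightarrow> 'a"
    by (rule exists_primitive[OF that]) blast
  ultimately show ?thesis by (intro conjI equalityI image_subsetI subsetI allI impI)
qed

end
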